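(* Let $G$ be a group, $H$ a hyperbolically embedded subgroup of $G$, $V$ a normed $G$-module, and $U$ an $H$-submodule of $V$. Then there exists an $\mathbb F$-linear map $$\iota \colon QZ^1_{as}(H,U)\to QZ^1_{as}(G,V)$$ such that for every $q\in QZ^1_{as}(H,U)$ we have $\iota(q)(h)=q(h)$ for all $h\in H$.
   Context: $\mathbb F$ is a subfield of $\mathbb C$; all modules are left, all vector spaces are over $\mathbb F$. For a discrete group $G$, a normed $G$-module is a normed vector space $V$ with a left action of $G$ by (linear) isometries. For a subgroup $H\le G$, an $H$-submodule of $V$ is an $H$-invariant subspace of $V$ with the induced action and norm. A map $q\colon G\to V$ is a (1-)quasi-cocycle if there is $\varepsilon>0$ with $\|q(fg)-q(f)-fq(g)\|\le\varepsilon$ for all $f,g\in G$; it is anti-symmetric if $q(g^{-1})=-g^{-1}q(g)$ for all $g\in G$. $QZ^1_{as}(G,V)$ is the $\mathbb F$-vector space of anti-symmetric quasi-cocycles $G\to V$. Hyperbolically embedded subgroups: let $H\le G$ and $X\subseteq G$ with $G=\langle X\cup H\rangle$. Let $\Gamma(G,X\sqcup (H\setminus\{1\}))$ be the Cayley graph of $G$ with edges labeled by letters of the disjoint union $X\sqcup (H\setminus\{1\})$ (letters representing the same element give multiple edges). The complete graph $\Gamma(H,H\setminus\{1\})$ is viewed as a subgraph. For $h,k\in H$ let $\widehat d(h,k)\in[0,+\infty]$ be the length of a shortest path in $\Gamma(G,X\sqcup (H\setminus\{1\}))$ from $h$ to $k$ having no edges in $\Gamma(H,H\setminus\{1\})$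 ($=\infty$ if none exists). $H$ is hyperbolically embedded in $G$ with respect to $X$ if (a) $G=\langle X\cup H\rangle$ and $\Gamma(G,X\sqcup (H\setminus\{1\}))$ is Gromov hyperbolic, and (b) $(H,\widehat d)$ is locally finite, i.e. every ball of finite radius contains finitely many elements. $H$ is hyperbolically embedded in $G$ if this holds for some (not necessarily finite) $X\subseteq G$. *)

theory Defs
  imports
    "HOL-Algebra.Group_Action"
    "HOL-Algebra.Generated_Groups"
    "HOL-Algebra.Subrings"
    "HOL-Library.Extended_Nat"
    "Graph_Theory.Arc_Walk"
    Complex_Main
begin

section \<open>Cayley graphs and hyperbolicity\<close>

text \<open>
  A letter \<open>s \<in> S\<close> represents the element \<open>val s\<close>, so distinct letters with the same value
  give multiple edges. The graph is undirected: the edge labelled \<open>s\<close> from \<open>g\<close> to \<open>g \<otimes> val s\<close>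
  is encoded by the two mutually inverse arcs \<open>(g, s, True)\<close> and \<open>(g, s, False)\<close>, so that a walk
  may traverse it in either direction.
\<close>

definition cayley_graph ::
  "('g, 'm) monoid_scheme \<Rightarrow> ('s \<Rightarrow> 'g) \<Rightarrow> 's set \<Rightarrow> ('g, 'g \<times> 's \<times> bool) pre_digraph"
  where "cayley_graph G val S =
    \<lparr>verts = carrier G,
     arcs = carrier G \<times> S \<times> UNIV,
     tail = (\<lambda>(g, s, fwd). if fwd then g else g \<otimes>\<^bsub>G\<^esub> val s),
     head = (\<lambda>(g, s, fwd). if fwd then g \<otimes>\<^bsub>G\<^esub> val s else g)\<rparr>"

text \<open>The value is \<open>\<infinity>\<close> if there is no walk from \<open>u\<close> to \<open>v\<close>.\<close>

definition graph_dist :: "('a, 'b) pre_digraph \<Rightarrow> 'a \<Rightarrow> 'a \<Rightarrow> enat"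
  where "graph_dist \<Gamma> u v = (INF p \<in> {p. pre_digraph.awalk \<Gamma> u p v}. enat (length p))"

definition geodesic :: "('a, 'b) pre_digraph \<Rightarrow> 'a \<Rightarrow> 'b list \<Rightarrow> 'a \<Rightarrow> bool"
  where "geodesic \<Gamma> u p v \<longleftrightarrow>
    pre_digraph.awalk \<Gamma> u p v \<and> enat (length p) = graph_dist \<Gamma> u v"

text \<open>
  Gromov hyperbolicity in the form of the Rips condition: all geodesic triangles are uniformly
  slim. As usual for graphs, the corners are vertices and sides are compared through their
  vertices; this changes only the constant \<open>\<delta>\<close>.
\<close>

definition gromov_hyperbolic :: "('a, 'b) pre_digraph \<Rightarrow> bool"
  where "gromov_hyperbolic \<Gamma> \<longleftrightarrow>
    (\<exists>\<delta>::nat. \<forall>x y z p q r.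
       geodesic \<Gamma> x p y \<and> geodesic \<Gamma> y q z \<and> geodesic \<Gamma> z r x \<longrightarrow>
       (\<forall>w \<in> set (pre_digraph.awalk_verts \<Gamma> x p).
          \<exists>w' \<in> set (pre_digraph.awalk_verts \<Gamma> y q) \<union> set (pre_digraph.awalk_verts \<Gamma> z r).
            graph_dist \<Gamma> w w' \<le> enat \<delta>))"


section \<open>Hyperbolically embedded subgroups\<close>

text \<open>The alphabet is the disjoint union of \<open>X\<close> and \<open>H - {\<one>}\<close>, as a subset of a sum type.\<close>

abbreviation letter_value :: "'g + 'g \<Rightarrow> 'g"
  where "letter_value \<equiv> case_sum id id"

definition rel_cayley_graph ::
  "('g, 'm) monoid_scheme \<Rightarrow> 'g set \<Rightarrow> 'g set \<Rightarrow> ('g, 'g \<times> ('g + 'g) \<times> bool) pre_digraph"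
  where "rel_cayley_graph G H X = cayley_graph G letter_value (Inl ` X \<union> Inr ` (H - {\<one>\<^bsub>G\<^esub>}))"

text \<open>
  The complete graph on \<open>H\<close>, as a subgraph of \<open>rel_cayley_graph G H X\<close>: its edges are those with
  endpoints in \<open>H\<close> whose label comes from the \<open>H\<close>-part of the alphabet. Edges with label in \<open>X\<close>
  do not belong to it, even if they join elements of \<open>H\<close>.
\<close>

definition subgroup_cayley_graph ::
  "('g, 'm) monoid_scheme \<Rightarrow> 'g set \<Rightarrow> ('g, 'g \<times> ('g + 'g) \<times> bool) pre_digraph"
  where "subgroup_cayley_graph G H =
    cayley_graph (G\<lparr>carrier := H\<rparr>) letter_value (Inr ` (H - {\<one>\<^bsub>G\<^esub>}))"

definition rel_dist :: "('g, 'm) monoid_scheme \<Rightarrow> 'g set \<Rightarrow> 'g set \<Rightarrow> 'g \<Rightarrow> 'g \<Rightarrow> enat"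
  where "rel_dist G H X h k =
    (INF p \<in> {p. pre_digraph.awalk (rel_cayley_graph G H X) h p k \<and>
                 set p \<inter> arcs (subgroup_cayley_graph G H) = {}}. enat (length p))"

definition hyperbolically_embedded_wrt ::
  "('g, 'm) monoid_scheme \<Rightarrow> 'g set \<Rightarrow> 'g set \<Rightarrow> bool"
  where "hyperbolically_embedded_wrt G H X \<longleftrightarrow>
    subgroup H G \<and> X \<subseteq> carrier G \<and>
    generate G (X \<union> H) = carrier G \<and>
    gromov_hyperbolic (rel_cayley_graph G H X) \<and>
    (\<forall>h \<in> H. \<forall>n::nat. finite {k \<in> H. rel_dist G H X h k \<le> enat n})"

definition hyperbolically_embedded :: "('g, 'm) monoid_scheme \<Rightarrow> 'g set \<Rightarrow> bool"
  where "hyperbolically_embedded G H \<longleftrightarrow> (\<exists>X. hyperbolically_embedded_wrt G H X)"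


section \<open>Normed modules\<close>

definition complex_ring :: "complex ring"
  where "complex_ring = \<lparr>carrier = UNIV, mult = (*), one = 1, zero = 0, add = (+)\<rparr>"

text \<open>
  A normed space over a subfield \<open>F\<close> of the complex numbers, whose underlying abelian group is a
  type. Only the values of \<open>scale\<close> on \<open>F\<close> are constrained.
\<close>

locale normed_space_over =
  fixes F :: "complex set"
    and scale :: "complex \<Rightarrow> 'v::ab_group_add \<Rightarrow> 'v"
    and nrm :: "'v \<Rightarrow> real"
  assumes subfield: "subfield F complex_ring"
    and scale_right_distrib: "a \<in> F \<Longrightarrow> scale a (x + y) = scale a x + scale a y"
    and scale_left_distrib: "a \<in> F \<Longrightarrow> b \<in> F \<Longrightarrow> scale (a + b) x = scale a x + scale b x"
    and scale_scale: "a \<in> F \<Longrightarrow> b \<in> F \<Longrightarrow> scale a (scale b x) = scale (a * b) x"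
    and scale_one: "scale 1 x = x"
    and nrm_nonneg: "0 \<le> nrm x"
    and nrm_eq_zero_iff: "nrm x = 0 \<longleftrightarrow> x = 0"
    and nrm_triangle: "nrm (x + y) \<le> nrm x + nrm y"
    and nrm_scale: "a \<in> F \<Longrightarrow> nrm (scale a x) = cmod a * nrm x"

locale normed_module =
  normed_space_over F scale nrm + group_action G UNIV act
  for F :: "complex set"
    and scale :: "complex \<Rightarrow> 'v::ab_group_add \<Rightarrow> 'v"
    and nrm :: "'v \<Rightarrow> real"
    and G :: "('g, 'm) monoid_scheme"
    and act :: "'g \<Rightarrow> 'v \<Rightarrow> 'v" +
  assumes act_add: "g \<in> carrier G \<Longrightarrow> act g (x + y) = act g x + act g y"
    and act_scale: "g \<in> carrier G \<Longrightarrow> a \<in> F \<Longrightarrow> act g (scale a x) = scale a (act g x)"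
    and act_isometry: "g \<in> carrier G \<Longrightarrow> nrm (act g x) = nrm x"

locale invariant_subspace =
  fixes F :: "complex set"
    and scale :: "complex \<Rightarrow> 'v::ab_group_add \<Rightarrow> 'v"
    and act :: "'g \<Rightarrow> 'v \<Rightarrow> 'v"
    and H :: "'g set"
    and U :: "'v set"
  assumes zero_mem: "0 \<in> U"
    and add_mem: "u \<in> U \<Longrightarrow> v \<in> U \<Longrightarrow> u + v \<in> U"
    and scale_mem: "a \<in> F \<Longrightarrow> u \<in> U \<Longrightarrow> scale a u \<in> U"
    and act_mem: "h \<in> H \<Longrightarrow> u \<in> U \<Longrightarrow> act h u \<in> U"


section \<open>Quasi-cocycles\<close>

definition quasi_cocycle ::
  "('g, 'm) monoid_scheme \<Rightarrow> ('g \<Rightarrow> 'v::ab_group_add \<Rightarrow> 'v) \<Rightarrow> ('v \<Rightarrow> real) \<Rightarrow> ('g \<Rightarrow> 'v) \<Rightarrow> bool"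
  where "quasi_cocycle G act nrm q \<longleftrightarrow>
    (\<exists>\<epsilon>>0. \<forall>f \<in> carrier G. \<forall>g \<in> carrier G. nrm (q (f \<otimes>\<^bsub>G\<^esub> g) - q f - act f (q g)) \<le> \<epsilon>)"

definition antisymmetric ::
  "('g, 'm) monoid_scheme \<Rightarrow> ('g \<Rightarrow> 'v::ab_group_add \<Rightarrow> 'v) \<Rightarrow> ('g \<Rightarrow> 'v) \<Rightarrow> bool"
  where "antisymmetric G act q \<longleftrightarrow>
    (\<forall>g \<in> carrier G. q (inv\<^bsub>G\<^esub> g) = - act (inv\<^bsub>G\<^esub> g) (q g))"

text \<open>
  The anti-symmetric quasi-cocycles \<open>G \<rightarrow> U\<close>. Maps on \<open>carrier G\<close> are extensional, so that two
  elements of this set are equal if and only if they agree on \<open>carrier G\<close>; the vector space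
  operations are pointwise, restricted to \<open>carrier G\<close>.
\<close>

definition QZ1_as ::
  "('g, 'm) monoid_scheme \<Rightarrow> ('g \<Rightarrow> 'v::ab_group_add \<Rightarrow> 'v) \<Rightarrow> ('v \<Rightarrow> real) \<Rightarrow> 'v set \<Rightarrow> ('g \<Rightarrow> 'v) set"
  where "QZ1_as G act nrm U =
    {q \<in> carrier G \<rightarrow>\<^sub>E U. quasi_cocycle G act nrm q \<and> antisymmetric G act q}"

text \<open>
  \<open>T\<close> is an \<open>F\<close>-linear map from \<open>P\<close> to \<open>Q\<close>, where \<open>P\<close> and \<open>Q\<close> are spaces of extensional maps
  on \<open>A\<close> and \<open>B\<close> with the pointwise operations.
\<close>

definition linear_map_between ::
  "complex set \<Rightarrow> (complex \<Rightarrow> 'v::ab_group_add \<Rightarrow> 'v) \<Rightarrow> 'g set \<Rightarrow> 'g set \<Rightarrow>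
    ('g \<Rightarrow> 'v) set \<Rightarrow> ('g \<Rightarrow> 'v) set \<Rightarrow> (('g \<Rightarrow> 'v) \<Rightarrow> ('g \<Rightarrow> 'v)) \<Rightarrow> bool"
  where "linear_map_between F scale A B P Q T \<longleftrightarrow>
    T \<in> P \<rightarrow> Q \<and>
    (\<forall>p \<in> P. \<forall>q \<in> P. T (\<lambda>x\<in>A. p x + q x) = (\<lambda>x\<in>B. T p x + T q x)) \<and>
    (\<forall>a \<in> F. \<forall>p \<in> P. T (\<lambda>x\<in>A. scale a (p x)) = (\<lambda>x\<in>B. scale a (T p x)))"

end

theory Submission
  imports Defs
begin

text \<open>
  Let \<open>d\<close> be the distance in the relative Cayley graph. Every left coset \<open>A\<close> of \<open>H\<close> has diameter at
  most one, and every vertex \<open>f\<close> has a set \<open>\<pi>\<^sub>A(f)\<close> of nearest points in \<open>A\<close>. Within \<open>A\<close>, points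
  are compared by the length of walks that use no \<open>H\<close>-edge of \<open>A\<close>; by hypothesis balls for this
  finer distance are finite.

  The geometric input is \<open>isolated_clique_bound\<close>: if some geodesic from \<open>f\<close> to \<open>g\<close> uses no \<open>H\<close>-edge
  of \<open>A\<close>, then points of \<open>\<pi>\<^sub>A(f)\<close> and \<open>\<pi>\<^sub>A(g)\<close> are joined by a walk of bounded length that avoids the
  \<open>H\<close>-edges of \<open>A\<close>, because slimness of triangles lets a short detour through the geodesic
  replace the edge inside \<open>A\<close>. For \<open>f = g\<close> this makes \<open>\<pi>\<^sub>A(f)\<close> finite. Call \<open>A\<close> a separator of \<open>f\<close>
  and \<open>g\<close> if some points of \<open>\<pi>\<^sub>A(f)\<close> and \<open>\<pi>\<^sub>A(g)\<close> are far apart. All geodesics from \<open>f\<close> to \<open>g\<close> then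
  pass through \<open>A\<close>, at a position that determines \<open>A\<close>, so there are finitely many separators.

  A quasi-cocycle \<open>q\<close> on \<open>H\<close> assigns to \<open>u, v \<in> A\<close> the vector \<open>u q(u\<^sup>-\<^sup>1 v)\<close>, set to zero when \<open>u\<^sup>-\<^sup>1 v\<close>
  lies in a certain finite ball. Average it over \<open>\<pi>\<^sub>A(f) \<times> \<pi>\<^sub>A(g)\<close> and sum over the separators of \<open>f\<close>
  and \<open>g\<close>; the result \<open>Q(f, g)\<close> is equivariant and anti-symmetric, and is linear in \<open>q\<close>. Up to sign the
  failure of \<open>g \<mapsto> Q(1, g)\<close> to be a cocycle is \<open>Q(f, g) + Q(g, h) + Q(h, f)\<close> for a triangle, which
  splits into one defect for each coset. Each defect is bounded, as it averages defects
  of \<open>q\<close>. At most three are non-zero. Indeed, by the triangle inequality inside \<open>A\<close>, a non-zero defect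
  requires that \<open>A\<close> separates one corner from both others. But if \<open>A\<close> separates \<open>f\<close> from both \<open>g\<close> and \<open>h\<close>, and so does another
  coset farther from \<open>f\<close>, then \<open>\<pi>\<^sub>A(g) = \<pi>\<^sub>A(h)\<close> and the defect of \<open>A\<close> cancels. So only the last common
  separator seen from each corner matters (\<open>branching_at_most_one\<close>, \<open>defect_support\<close>). On \<open>H\<close> the
  map \<open>Q(1, h)\<close> is \<open>q(h)\<close> up to finitely many values, and overwriting it there by \<open>q\<close> is a bounded
  change.
\<close>

section \<open>Geodesics and projections to cliques in a graph\<close>

definition hops :: "'a rel \<Rightarrow> 'a \<Rightarrow> 'a \<Rightarrow> nat"
  where "hops E a b = (LEAST n. (a, b) \<in> E ^^ n)"

lemma sym_relpow:
  assumes "sym E"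
  shows "sym (E ^^ n)"
proof (induction n)
  case 0
  show ?case by (auto simp: sym_def)
next
  case (Suc n)
  have "(b, a) \<in> E ^^ Suc n" if ab: "(a, b) \<in> E ^^ Suc n" for a b
  proof -
    obtain c where "(a, c) \<in> E ^^ n" "(c, b) \<in> E" using ab by auto
    then have "(c, a) \<in> E ^^ n" "(b, c) \<in> E" using Suc assms by (auto dest: symD)
    then show ?thesis by (metis relpow_Suc_I2)
  qed
  then show ?case by (auto simp only: sym_def)
qed

lemma relpow_concat: "(a, b) \<in> E ^^ m \<Longrightarrow> (b, c) \<in> E ^^ n \<Longrightarrow> (a, c) \<in> E ^^ (m + n)"
  by (auto simp: relpow_add)

lemma relpow_hom:
  assumes "(a, b) \<in> E ^^ n" and "\<And>x y. (x, y) \<in> E \<Longrightarrow> (\<phi> x, \<phi> y) \<in> E'"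
  shows "(\<phi> a, \<phi> b) \<in> E' ^^ n"
  using assms(1)
proof (induction n arbitrary: b)
  case (Suc n)
  then obtain c where "(a, c) \<in> E ^^ n" "(c, b) \<in> E" by auto
  with Suc.IH assms(2) show ?case by auto
qed auto

locale connected_graph =
  fixes V :: "'a set" and E :: "'a rel"
  assumes edge_verts: "E \<subseteq> V \<times> V"
    and sym_edge: "sym E"
    and connected: "a \<in> V \<Longrightarrow> b \<in> V \<Longrightarrow> \<exists>n. (a, b) \<in> E ^^ n"
begin

abbreviation dst :: "'a \<Rightarrow> 'a \<Rightarrow> nat" where "dst \<equiv> hops E"

lemma hops_walk: "a \<in> V \<Longrightarrow> b \<in> V \<Longrightarrow> (a, b) \<in> E ^^ dst a b"
  unfolding hops_def by (rule LeastI_ex) (rule connected)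

lemma hops_le: "(a, b) \<in> E ^^ n \<Longrightarrow> dst a b \<le> n"
  unfolding hops_def by (rule Least_le)

lemma walk_end: "(a, b) \<in> E ^^ n \<Longrightarrow> a \<in> V \<Longrightarrow> b \<in> V"
  using edge_verts by (cases n) auto

lemma hops_refl [simp]: "dst a a = 0"
  using hops_le[of a a 0] by simp

lemma hops_eq_0: "a \<in> V \<Longrightarrow> b \<in> V \<Longrightarrow> dst a b = 0 \<Longrightarrow> a = b"
  using hops_walk[of a b] by simp

lemma hops_sym: "a \<in> V \<Longrightarrow> b \<in> V \<Longrightarrow> dst a b = dst b a"
  by (meson antisym hops_le hops_walk sym_edge sym_relpow symD)

lemma hops_triangle: "a \<in> V \<Longrightarrow> b \<in> V \<Longrightarrow> c \<in> V \<Longrightarrow> dst a c \<le> dst a b + dst b c"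
  by (intro hops_le relpow_concat[of _ b] hops_walk)

definition geo :: "(nat \<Rightarrow> 'a) \<Rightarrow> 'a \<Rightarrow> 'a \<Rightarrow> bool"
  where "geo \<gamma> a b \<longleftrightarrow> \<gamma> 0 = a \<and> \<gamma> (dst a b) = b \<and> (\<forall>i < dst a b. (\<gamma> i, \<gamma> (Suc i)) \<in> E)"

lemma geo_ex: "a \<in> V \<Longrightarrow> b \<in> V \<Longrightarrow> \<exists>\<gamma>. geo \<gamma> a b"
  using hops_walk[of a b] unfolding geo_def relpow_fun_conv by blast

lemma geo_walk:
  assumes "geo \<gamma> a b" and "i \<le> j" and "j \<le> dst a b"
  shows "(\<gamma> i, \<gamma> j) \<in> E ^^ (j - i)"
  unfolding relpow_fun_conv
  using assms by (intro exI[of _ "\<lambda>k. \<gamma> (i + k)"]) (auto simp: geo_def)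

lemma geo_verts: "geo \<gamma> a b \<Longrightarrow> a \<in> V \<Longrightarrow> i \<le> dst a b \<Longrightarrow> \<gamma> i \<in> V"
  using walk_end[OF geo_walk[of \<gamma> a b 0 i]] by (simp add: geo_def)

lemma geo_hops:
  assumes g: "geo \<gamma> a b" and V: "a \<in> V" "b \<in> V" and ij: "i \<le> j" "j \<le> dst a b"
  shows "dst (\<gamma> i) (\<gamma> j) = j - i"
proof -
  have e: "\<gamma> 0 = a" "\<gamma> (dst a b) = b" using g by (auto simp: geo_def)
  have "dst a (\<gamma> i) \<le> i" "dst (\<gamma> i) (\<gamma> j) \<le> j - i" "dst (\<gamma> j) b \<le> dst a b - j"
    using hops_le[OF geo_walk[OF g, of 0 i]] hops_le[OF geo_walk[OF g, of i j]]
      hops_le[OF geo_walk[OF g, of j "dst a b"]] ij e by auto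
  moreover have "dst a b \<le> dst a (\<gamma> i) + (dst (\<gamma> i) (\<gamma> j) + dst (\<gamma> j) b)"
    using hops_triangle[of a "\<gamma> i" b] hops_triangle[of "\<gamma> i" "\<gamma> j" b]
      geo_verts[OF g V(1), of i] geo_verts[OF g V(1), of j] V ij by auto
  ultimately show ?thesis using ij by linarith
qed

lemma geo_rev:
  assumes "geo \<gamma> a b" and "a \<in> V" "b \<in> V"
  shows "geo (\<lambda>i. \<gamma> (dst a b - i)) b a"
proof -
  have "(\<gamma> (dst a b - i), \<gamma> (dst a b - Suc i)) \<in> E" if "i < dst a b" for i
  proof -
    have "Suc (dst a b - Suc i) = dst a b - i" using that by simp
    then show ?thesis using assms(1) that sym_edge
      unfolding geo_def by (metis diff_less symD zero_less_Suc gr_implies_not0 not_gr_zero)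
  qed
  with assms(1) show ?thesis by (simp add: geo_def hops_sym[OF assms(3,2)])
qed

definition btw :: "'a \<Rightarrow> 'a \<Rightarrow> 'a \<Rightarrow> bool"
  where "btw a w b \<longleftrightarrow> w \<in> V \<and> dst a w + dst w b = dst a b"

lemma geo_btw: "geo \<gamma> a b \<Longrightarrow> a \<in> V \<Longrightarrow> b \<in> V \<Longrightarrow> i \<le> dst a b \<Longrightarrow> btw a (\<gamma> i) b"
  using geo_hops[of \<gamma> a b 0 i] geo_hops[of \<gamma> a b i "dst a b"] geo_verts[of \<gamma> a b i]
  by (auto simp: geo_def btw_def)

lemma geo_through:
  assumes V: "a \<in> V" "b \<in> V" and w: "btw a w b"
  shows "\<exists>\<gamma>. geo \<gamma> a b \<and> \<gamma> (dst a w) = w"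
proof -
  have wV: "w \<in> V" and s: "dst a b = dst a w + dst w b" using w by (auto simp: btw_def)
  obtain p q where p: "geo p a w" and q: "geo q w b"
    using geo_ex V wV by meson
  define \<gamma> where "\<gamma> i = (if i \<le> dst a w then p i else q (i - dst a w))" for i
  have "\<gamma> i = q (i - dst a w)" if "dst a w \<le> i" for i
    using p q that by (auto simp: \<gamma>_def geo_def)
  then have "(\<gamma> i, \<gamma> (Suc i)) \<in> E" if "i < dst a b" for i
    using p q that s by (cases "i < dst a w") (auto simp: \<gamma>_def geo_def Suc_diff_le)
  moreover have "\<gamma> 0 = a" "\<gamma> (dst a b) = b" "\<gamma> (dst a w) = w"
    using p q s by (auto simp: \<gamma>_def geo_def)
  ultimately show ?thesis unfolding geo_def by blast
qed

lemma btw_at: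
  assumes "a \<in> V" "b \<in> V" "k \<le> dst a b"
  obtains w where "btw a w b" "dst w b = k"
proof -
  obtain \<gamma> where g: "geo \<gamma> a b" using geo_ex assms by blast
  have "btw a (\<gamma> (dst a b - k)) b" using geo_btw[OF g assms(1,2)] by simp
  moreover have "dst (\<gamma> (dst a b - k)) b = k"
    using geo_hops[OF g assms(1,2), of "dst a b - k" "dst a b"] g assms(3) by (simp add: geo_def)
  ultimately show ?thesis using that by blast
qed

text \<open>
  The model is a coset of a subgroup \<open>H\<close> in a Cayley graph whose alphabet contains \<open>H - {\<one>}\<close>.
\<close>

definition clique :: "'a set \<Rightarrow> bool"
  where "clique A \<longleftrightarrow> A \<noteq> {} \<and> A \<subseteq> V \<and> (\<forall>a\<in>A. \<forall>b\<in>A. dst a b \<le> 1)"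

definition cdst :: "'a set \<Rightarrow> 'a \<Rightarrow> nat"
  where "cdst A f = (LEAST n. \<exists>a\<in>A. dst f a = n)"

definition proj :: "'a set \<Rightarrow> 'a \<Rightarrow> 'a set"
  where "proj A f = {a \<in> A. dst f a = cdst A f}"

lemma cdst_le: "a \<in> A \<Longrightarrow> cdst A f \<le> dst f a"
  unfolding cdst_def by (rule Least_le) blast

lemma proj_sub: "proj A f \<subseteq> A"
  by (auto simp: proj_def)

lemma proj_nonempty: "clique A \<Longrightarrow> proj A f \<noteq> {}"
  using LeastI_ex[of "\<lambda>n. \<exists>a\<in>A. dst f a = n"] by (auto simp: clique_def proj_def cdst_def)

lemma projI: "a \<in> A \<Longrightarrow> dst f a \<le> cdst A f \<Longrightarrow> a \<in> proj A f"
  using cdst_le[of a A f] by (auto simp: proj_def)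

lemma cdst_eqI: "a \<in> A \<Longrightarrow> (\<And>b. b \<in> A \<Longrightarrow> dst f a \<le> dst f b) \<Longrightarrow> cdst A f = dst f a"
  unfolding cdst_def by (rule Least_equality) auto

definition crosses :: "'a set \<Rightarrow> 'a \<Rightarrow> 'a \<Rightarrow> bool"
  where "crosses A f g \<longleftrightarrow>
    (\<forall>\<gamma>. geo \<gamma> f g \<longrightarrow> (\<exists>i < dst f g. \<gamma> i \<in> A \<and> \<gamma> (Suc i) \<in> A))"

text \<open>
  A geodesic can take a step inside a clique only at the moment when it is closest to it. Entering
  through a point farther away than the nearest one would be wasteful, since one step inside
  the clique reaches any of its points.
\<close>

lemma geo_clique_step:
  assumes g: "geo \<gamma> f g" and V: "f \<in> V" "g \<in> V" and A: "clique A"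
    and i: "i < dst f g" "\<gamma> i \<in> A" "\<gamma> (Suc i) \<in> A"
  shows "cdst A f = i" and "cdst A g = dst f g - Suc i"
proof -
  have AV: "A \<subseteq> V" and d1: "\<And>a b. a \<in> A \<Longrightarrow> b \<in> A \<Longrightarrow> dst a b \<le> 1"
    using A by (auto simp: clique_def)
  have ends: "\<gamma> 0 = f" "\<gamma> (dst f g) = g" using g by (auto simp: geo_def)
  have d: "dst f (\<gamma> i) = i" "dst f (\<gamma> (Suc i)) = Suc i"
      "dst (\<gamma> (Suc i)) g = dst f g - Suc i" "dst (\<gamma> i) g = dst f g - i"
    using geo_hops[OF g V, of 0 i] geo_hops[OF g V, of 0 "Suc i"]
      geo_hops[OF g V, of "Suc i" "dst f g"] geo_hops[OF g V, of i "dst f g"] i(1) ends by auto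
  have iV: "\<gamma> i \<in> V" "\<gamma> (Suc i) \<in> V" using i AV by auto
  have "dst f (\<gamma> i) \<le> dst f a" if "a \<in> A" for a
    using hops_triangle[of f a "\<gamma> (Suc i)"] d1[of a "\<gamma> (Suc i)"] d that i(2,3) AV V iV by fastforce
  then show "cdst A f = i" using cdst_eqI[of "\<gamma> i" A f] d i by auto
  have "dst g (\<gamma> (Suc i)) \<le> dst g a" if "a \<in> A" for a
    using hops_triangle[of g a "\<gamma> i"] d1[of a "\<gamma> i"] d that i AV V iV
      hops_sym[OF V(2) iV(1)] hops_sym[OF V(2) iV(2)] by fastforce
  then show "cdst A g = dst f g - Suc i"
    using cdst_eqI[of "\<gamma> (Suc i)" A g] d i hops_sym[OF V(2) iV(2)] by auto
qed

lemma crosses_hops: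
  assumes "crosses A f g" "clique A" "f \<in> V" "g \<in> V"
  shows "dst f g = cdst A f + 1 + cdst A g"
proof -
  obtain \<gamma> where g: "geo \<gamma> f g" using geo_ex assms by blast
  then obtain i where i: "i < dst f g" "\<gamma> i \<in> A" "\<gamma> (Suc i) \<in> A"
    using assms(1) unfolding crosses_def by blast
  from geo_clique_step[OF g assms(3,4,2) i] i(1) show ?thesis by simp
qed

text \<open>
  Crossing a clique makes all its nearest points interchangeable: the geodesic may be rerouted
  to leave the clique through any point of the projection of its far end.
\<close>

lemma proj_btw:
  assumes "crosses A f g" "clique A" "f \<in> V" "g \<in> V" and v: "v \<in> proj A g"
  shows "btw f v g" and "dst f v = cdst A f + 1"
proof -
  have AV: "A \<subseteq> V" and d1: "\<And>a b. a \<in> A \<Longrightarrow> b \<in> A \<Longrightarrow> dst a b \<le> 1"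
    using assms by (auto simp: clique_def)
  obtain u where u: "u \<in> A" "dst f u = cdst A f"
    using proj_nonempty[OF assms(2), of f] by (auto simp: proj_def)
  have vA: "v \<in> A" "dst g v = cdst A g" using v by (auto simp: proj_def)
  then have vV: "v \<in> V" using AV by blast
  have "dst f v \<le> cdst A f + 1"
    using hops_triangle[of f u v] u vA d1[of u v] AV assms(3) by fastforce
  moreover have "dst f g \<le> dst f v + dst v g" using hops_triangle assms vV by blast
  moreover have "dst v g = cdst A g" using hops_sym[OF vV assms(4)] vA by simp
  ultimately show "btw f v g" "dst f v = cdst A f + 1"
    using crosses_hops[OF assms(1-4)] vV by (auto simp: btw_def)
qed

lemma crosses_same_position:
  assumes "crosses A f g" "crosses B f g" "clique A" "clique B" "f \<in> V" "g \<in> V"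
    and "cdst A f = cdst B f"
  shows "A \<inter> B \<noteq> {}"
proof -
  obtain \<gamma> where g: "geo \<gamma> f g" using geo_ex assms by blast
  obtain i j where i: "i < dst f g" "\<gamma> i \<in> A" "\<gamma> (Suc i) \<in> A"
      and j: "j < dst f g" "\<gamma> j \<in> B" "\<gamma> (Suc j) \<in> B"
    using assms(1,2) g unfolding crosses_def by meson
  have "i = j" using geo_clique_step(1)[OF g assms(5,6)] assms(3,4,7) i j by metis
  with i j show ?thesis by blast
qed

text \<open>
  If \<open>A\<close> and a later clique \<open>B\<close> both lie between \<open>f\<close> and each of \<open>g\<close>, \<open>h\<close>, then the nearest points
  of \<open>A\<close> as seen from \<open>g\<close> and from \<open>h\<close> are already determined by \<open>B\<close>: geodesics to \<open>g\<close> and to \<open>h\<close>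
  run through \<open>B\<close>, and what they do after \<open>B\<close> does not influence where they leave \<open>A\<close>.
\<close>

lemma proj_eq_if_later_crossing:
  assumes Ag: "crosses A f g" and Ah: "crosses A f h"
    and Bg: "crosses B f g" and Bh: "crosses B f h"
    and A: "clique A" and B: "clique B" and V: "f \<in> V" "g \<in> V" "h \<in> V"
    and less: "cdst A f < cdst B f"
  shows "proj A g = proj A h"
proof -
  have main: "proj A g \<subseteq> proj A h"
    if Ag: "crosses A f g" and Ah: "crosses A f h"
      and Bg: "crosses B f g" and Bh: "crosses B f h" and V: "g \<in> V" "h \<in> V" for g h
  proof
    fix v assume v: "v \<in> proj A g"
    have fV: "f \<in> V" by fact
    have vA: "v \<in> A" and vV: "v \<in> V" using v A by (auto simp: proj_def clique_def)
    from proj_btw[OF Ag A fV V(1) v] obtain \<gamma> where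
      g: "geo \<gamma> f g" and gv: "\<gamma> (cdst A f + 1) = v"
      using geo_through[OF fV V(1)] by metis
    obtain j where j: "j < dst f g" "\<gamma> j \<in> B" "\<gamma> (Suc j) \<in> B"
      using Bg g unfolding crosses_def by blast
    have jB: "cdst B f = j" using geo_clique_step(1)[OF g fV V(1) B j] .
    have xV: "\<gamma> j \<in> V" using j B by (auto simp: clique_def)
    have "dst v (\<gamma> j) = j - (cdst A f + 1)"
      using geo_hops[OF g fV V(1), of "cdst A f + 1" j] gv j jB less by auto
    moreover have "dst (\<gamma> j) h \<le> 1 + cdst B h"
    proof -
      obtain y where y: "y \<in> B" "dst h y = cdst B h"
        using proj_nonempty[OF B, of h] by (auto simp: proj_def)
      then have "y \<in> V" "dst (\<gamma> j) y \<le> 1" using B j by (auto simp: clique_def)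
      then show ?thesis
        using hops_triangle[OF xV, of y h] hops_sym[of y h] y V by auto
    qed
    moreover have "dst v h \<le> dst v (\<gamma> j) + dst (\<gamma> j) h" using hops_triangle vV xV V by blast
    ultimately have "dst v h \<le> cdst A h"
      using crosses_hops[OF Bh B fV V(2)] crosses_hops[OF Ah A fV V(2)] jB less by linarith
    then show "v \<in> proj A h" using projI[OF vA] hops_sym[OF vV V(2)] by simp
  qed
  show ?thesis using main[OF Ag Ah Bg Bh V(2,3)] main[OF Ah Ag Bh Bg V(3,2)] by blast
qed

text \<open>
  The relation \<open>E'\<close> stands for the graph with some edges inside \<open>A\<close> removed. A geodesic to
  a nearest point of \<open>A\<close> meets \<open>A\<close> only at its end, hence survives the removal.
\<close>

lemma walk_to_proj_avoids:
  assumes E': "E - A \<times> A \<subseteq> E'" and A: "A \<subseteq> V" and f: "f \<in> V"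
    and u: "u \<in> proj A f" and r: "btw f r u"
  shows "(r, u) \<in> E' ^^ dst r u"
proof -
  have rV: "r \<in> V" using r by (auto simp: btw_def)
  have uV: "u \<in> V" using u A by (auto simp: proj_def)
  obtain c where c: "geo c r u" using geo_ex[OF rV uV] by blast
  have "c i \<notin> A" if i: "i < dst r u" for i
  proof
    assume "c i \<in> A"
    then have "dst f u \<le> dst f (c i)" using cdst_le[of "c i" A f] u by (simp add: proj_def)
    also have "\<dots> \<le> dst f r + dst r (c i)"
      using hops_triangle[OF f rV] geo_verts[OF c rV, of i] i by simp
    also have "dst r (c i) = i" using geo_hops[OF c rV uV, of 0 i] c i by (simp add: geo_def)
    finally show False using r i by (auto simp: btw_def)
  qed
  then show ?thesis using c E' unfolding geo_def relpow_fun_conv by blast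
qed

lemma short_walk_avoids:
  assumes E': "E - A \<times> A \<subseteq> E'" and V: "r \<in> V" "s \<in> V"
    and far: "\<And>a. a \<in> A \<Longrightarrow> dst r s < dst r a"
  shows "(r, s) \<in> E' ^^ dst r s"
proof -
  obtain c where c: "geo c r s" using geo_ex[OF V] by blast
  have "c i \<notin> A" if i: "i < dst r s" for i
    using far[of "c i"] geo_hops[OF c V, of 0 i] c i by (auto simp: geo_def)
  then show ?thesis using c E' unfolding geo_def relpow_fun_conv by blast
qed

end

section \<open>Bypassing a clique in a slim graph\<close>

locale slim_graph = connected_graph +
  fixes \<delta> :: nat
  assumes slim: "x \<in> V \<Longrightarrow> y \<in> V \<Longrightarrow> z \<in> V \<Longrightarrow> geo p x y \<Longrightarrow> geo q y z \<Longrightarrow> geo r z x \<Longrightarrow>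
    i \<le> dst x y \<Longrightarrow> (\<exists>j \<le> dst y z. dst (p i) (q j) \<le> \<delta>) \<or> (\<exists>j \<le> dst z x. dst (p i) (r j) \<le> \<delta>)"
begin

text \<open>
  Slimness for a point that is known only to lie between two corners of a triangle, with one of the
  other sides prescribed.
\<close>

lemma slim_btw:
  assumes V: "x \<in> V" "y \<in> V" "z \<in> V" and w: "btw x w y" and q: "geo q y z"
  shows "(\<exists>j \<le> dst y z. dst w (q j) \<le> \<delta>) \<or> (\<exists>t. btw z t x \<and> dst w t \<le> \<delta>)"
proof -
  obtain p where p: "geo p x y" "p (dst x w) = w" using geo_through[OF V(1,2) w] by blast
  obtain r where r: "geo r z x" using geo_ex V by blast
  have "dst x w \<le> dst x y" using w by (simp add: btw_def)
  from slim[OF V p(1) q r this] p(2) show ?thesis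
    using geo_btw[OF r V(3,1)] by metis
qed

text \<open>
  Consider the quadrilateral \<open>f, u, v, g\<close>. Follow the side from \<open>u\<close> to its end \<open>f\<close>, or far enough to be able
  to make a detour of length \<open>2 * \<delta>\<close> without touching \<open>A\<close>. Slimness of the two triangles cut
  off by the diagonal from \<open>f\<close> to \<open>v\<close> then leads either to the side from \<open>v\<close> to \<open>g\<close>, and back along it
  to \<open>v\<close>, or to the side \<open>\<gamma>\<close>.
\<close>

lemma leave_clique:
  assumes E': "E - A \<times> A \<subseteq> E'" and symE': "sym E'" and A: "clique A"
    and V: "f \<in> V" "g \<in> V" and u: "u \<in> proj A f" and v: "v \<in> proj A g"
    and \<gamma>: "geo \<gamma> f g"
  shows "(\<exists>n \<le> 8 * \<delta> + 3. (u, v) \<in> E' ^^ n) \<or>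
         (\<exists>i \<le> dst f g. \<exists>n \<le> 4 * \<delta> + 1. (u, \<gamma> i) \<in> E' ^^ n)"
proof -
  have AV: "A \<subseteq> V" and d1: "\<And>a b. a \<in> A \<Longrightarrow> b \<in> A \<Longrightarrow> dst a b \<le> 1"
    using A by (auto simp: clique_def)
  have uA: "u \<in> A" and vA: "v \<in> A" using u v by (auto simp: proj_def)
  then have uV: "u \<in> V" and vV: "v \<in> V" using AV by auto
  note rev = symD[OF sym_relpow[OF symE']]
  show ?thesis
  proof (cases "dst f u \<le> 2 * \<delta> + 1")
    case True
    have "(f, u) \<in> E' ^^ dst f u"
      by (rule walk_to_proj_avoids[OF E' AV V(1) u]) (simp add: btw_def V)
    moreover have "\<gamma> 0 = f" using \<gamma> by (simp add: geo_def)
    ultimately have "(u, \<gamma> 0) \<in> E' ^^ dst f u" using rev by simp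
    moreover have "dst f u \<le> 4 * \<delta> + 1" using True by simp
    ultimately show ?thesis by blast
  next
    case False
    then obtain r where r: "btw f r u" "dst r u = 2 * \<delta> + 1"
      using btw_at[OF V(1) uV, of "2 * \<delta> + 1"] by auto
    then have rV: "r \<in> V" by (simp add: btw_def)
    \<comment> \<open>The distance from \<open>r\<close> to \<open>A\<close> is exactly \<open>2 * \<delta> + 1\<close>, because \<open>u\<close> is nearest to \<open>f\<close>.\<close>
    have far: "2 * \<delta> < dst r a" if "a \<in> A" for a
    proof -
      have "dst f u \<le> dst f a" using u cdst_le[OF that, of f] by (simp add: proj_def)
      then show ?thesis
        using hops_triangle[OF V(1) rV, of a] that AV r by (auto simp: btw_def)
    qed
    have ru: "(u, r) \<in> E' ^^ (2 * \<delta> + 1)"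
      using walk_to_proj_avoids[OF E' AV V(1) u r(1)] r(2) rev by metis
    obtain q where q: "geo q u v" using geo_ex uV vV by blast
    \<comment> \<open>The side from \<open>u\<close> to \<open>v\<close> has at most two vertices, both in \<open>A\<close>.\<close>
    have "\<not> dst r (q j) \<le> \<delta>" if j: "j \<le> dst u v" for j
    proof -
      have "j = 0 \<or> j = dst u v" using j d1[OF uA vA] by linarith
      then have "q j \<in> A" using q uA vA by (auto simp: geo_def)
      then show ?thesis using far[of "q j"] by simp
    qed
    then obtain t where t: "btw v t f" "dst r t \<le> \<delta>"
      using slim_btw[OF V(1) uV vV r(1) q] by blast
    then have tV: "t \<in> V" by (simp add: btw_def)
    have hop: "(u, s) \<in> E' ^^ (2 * \<delta> + 1 + dst r s) \<and> dst r s \<le> 2 * \<delta>"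
      if "s \<in> V" "dst t s \<le> \<delta>" for s
    proof -
      have "dst r s \<le> 2 * \<delta>" using hops_triangle[OF rV tV that(1)] that t by simp
      then show ?thesis
        using short_walk_avoids[OF E' rV that(1)] far relpow_concat[OF ru]
        by (meson le_less_trans)
    qed
    consider (a) j where "j \<le> dst f g" "dst t (\<gamma> j) \<le> \<delta>"
      | (b) s where "btw g s v" "dst t s \<le> \<delta>"
      using slim_btw[OF vV V(1,2) t(1) \<gamma>] by blast
    then show ?thesis
    proof cases
      case a
      from hop[OF geo_verts[OF \<gamma> V(1) a(1)] a(2)]
      have "(u, \<gamma> j) \<in> E' ^^ (2 * \<delta> + 1 + dst r (\<gamma> j))"
        "2 * \<delta> + 1 + dst r (\<gamma> j) \<le> 4 * \<delta> + 1" by auto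
      with a(1) show ?thesis by blast
    next
      case b
      then have sV: "s \<in> V" by (simp add: btw_def)
      have sv: "(s, v) \<in> E' ^^ dst s v" using walk_to_proj_avoids[OF E' AV V(2) v b(1)] .
      have us: "(u, s) \<in> E' ^^ (2 * \<delta> + 1 + dst r s)" "dst r s \<le> 2 * \<delta>"
        using hop[OF sV b(2)] by auto
      have "dst s v \<le> dst s r + (dst r u + dst u v)"
        using hops_triangle[OF sV rV vV] hops_triangle[OF rV uV vV] by simp
      then have "dst s v \<le> 4 * \<delta> + 2"
        using d1[OF uA vA] r(2) us(2) hops_sym[OF sV rV] by simp
      then have "2 * \<delta> + 1 + dst r s + dst s v \<le> 8 * \<delta> + 3" using us(2) by simp
      then show ?thesis using relpow_concat[OF us(1) sv] by blast
    qed
  qed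
qed

text \<open>
  A geodesic that uses none of the removed edges serves as a bypass: leave \<open>A\<close> near \<open>u\<close>, follow the
  geodesic, and return near \<open>v\<close>. The part along the geodesic is short because it joins
  points close to \<open>u\<close> and to \<open>v\<close>, which are at distance at most one.
\<close>

lemma isolated_clique_bound:
  assumes E': "E - A \<times> A \<subseteq> E'" and symE': "sym E'" and A: "clique A"
    and V: "f \<in> V" "g \<in> V" and u: "u \<in> proj A f" and v: "v \<in> proj A g"
    and \<gamma>: "geo \<gamma> f g" and avoid: "\<And>i. i < dst f g \<Longrightarrow> (\<gamma> i, \<gamma> (Suc i)) \<in> E'"
    and sub: "E' \<subseteq> E"
  shows "\<exists>n \<le> 16 * \<delta> + 5. (u, v) \<in> E' ^^ n"
proof -
  note rev = symD[OF sym_relpow[OF symE']]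
  have uA: "u \<in> A" and vA: "v \<in> A" using u v by (auto simp: proj_def)
  then have uV: "u \<in> V" and vV: "v \<in> V" and uv: "dst u v \<le> 1" using A by (auto simp: clique_def)
  note \<gamma>r = geo_rev[OF \<gamma> V]
  consider (a) n where "n \<le> 8 * \<delta> + 3" "(u, v) \<in> E' ^^ n \<or> (v, u) \<in> E' ^^ n"
    | (b) i j m n where "i \<le> dst f g" "j \<le> dst f g" "m \<le> 4 * \<delta> + 1" "n \<le> 4 * \<delta> + 1"
        "(u, \<gamma> i) \<in> E' ^^ m" "(v, \<gamma> j) \<in> E' ^^ n"
    using leave_clique[OF E' symE' A V u v \<gamma>] leave_clique[OF E' symE' A V(2,1) v u \<gamma>r]
    by (metis diff_le_self)
  then show ?thesis
  proof cases
    case a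
    then have "n \<le> 16 * \<delta> + 5" "(u, v) \<in> E' ^^ n" using rev by auto
    then show ?thesis by blast
  next
    case b
    define k where "k = max i j - min i j"
    have "(\<gamma> (min i j), \<gamma> (max i j)) \<in> E' ^^ k"
      unfolding relpow_fun_conv k_def
      using avoid b(1,2) by (intro exI[of _ "\<lambda>l. \<gamma> (min i j + l)"]) auto
    then have ij: "(\<gamma> i, \<gamma> j) \<in> E' ^^ k" using rev by (cases "i \<le> j") (auto simp: max_def min_def)
    have "dst (\<gamma> (min i j)) (\<gamma> (max i j)) = k"
      unfolding k_def using geo_hops[OF \<gamma> V] b(1,2) by simp
    then have "k = dst (\<gamma> i) (\<gamma> j)"
      using hops_sym[OF geo_verts[OF \<gamma> V(1) b(1)] geo_verts[OF \<gamma> V(1) b(2)]]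
      by (cases "i \<le> j") (auto simp: max_def min_def)
    also have "\<dots> \<le> dst (\<gamma> i) u + (dst u v + dst v (\<gamma> j))"
      using hops_triangle uV vV geo_verts[OF \<gamma> V(1) b(1)] geo_verts[OF \<gamma> V(1) b(2)]
      by (meson add_left_mono order_trans)
    also have "\<dots> \<le> m + (1 + n)"
    proof -
      have "E' ^^ l \<subseteq> E ^^ l" for l by (induction l) (use sub in auto)
      then have "dst u (\<gamma> i) \<le> m" "dst v (\<gamma> j) \<le> n" using b hops_le by blast+
      then show ?thesis using uv hops_sym[OF uV geo_verts[OF \<gamma> V(1) b(1)]] by simp
    qed
    finally have "m + k + n \<le> 16 * \<delta> + 5" using b(3,4) by simp
    moreover have "(u, v) \<in> E' ^^ (m + k + n)"
      using relpow_concat[OF relpow_concat[OF b(5) ij] rev[OF b(6)]] by simp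
    ultimately show ?thesis by blast
  qed
qed

end

section \<open>The relative Cayley graph\<close>

locale relative_cayley = group G for G (structure) +
  fixes H X :: "'a set"
  assumes subgroup_H: "subgroup H G"
    and X_carrier: "X \<subseteq> carrier G"
    and generated: "generate G (X \<union> H) = carrier G"
begin

lemma H_carrier: "h \<in> H \<Longrightarrow> h \<in> carrier G"
  using subgroup.mem_carrier[OF subgroup_H] .

lemma inv_mult_left:
  assumes "k \<in> carrier G" "a \<in> carrier G" "b \<in> carrier G"
  shows "inv (k \<otimes> a) \<otimes> (k \<otimes> b) = inv a \<otimes> b"
  using assms by (simp add: inv_mult_group m_assoc inv_solve_left')

lemma inv_mult_chain:
  assumes "a \<in> carrier G" "b \<in> carrier G" "c \<in> carrier G"
  shows "inv a \<otimes> b \<otimes> (inv b \<otimes> c) = inv a \<otimes> c"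
  using assms by (metis inv_closed inv_solve_left m_assoc m_closed)

lemma inv_inv_mult: "a \<in> carrier G \<Longrightarrow> b \<in> carrier G \<Longrightarrow> inv (inv a \<otimes> b) = inv b \<otimes> a"
  by (simp add: inv_mult_group)

definition X_edges :: "'a rel"
  where "X_edges = {(a, b). a \<in> carrier G \<and> b \<in> carrier G \<and> (\<exists>s\<in>X. b = a \<otimes> s \<or> a = b \<otimes> s)}"

definition H_edges :: "'a rel"
  where "H_edges = {(a, b). a \<in> carrier G \<and> b \<in> carrier G \<and> inv a \<otimes> b \<in> H - {\<one>}}"

definition edges :: "'a rel"
  where "edges = X_edges \<union> H_edges"

text \<open>
  An edge labelled by \<open>X\<close> may well join two points of \<open>A\<close>; only the edges labelled by \<open>H\<close> are
  removed, as in the definition of \<^const>\<open>rel_dist\<close>.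
\<close>

definition edges_off :: "'a set \<Rightarrow> 'a rel"
  where "edges_off A = X_edges \<union> (H_edges - A \<times> A)"

lemma edges_carrier: "edges \<subseteq> carrier G \<times> carrier G"
  by (auto simp: edges_def X_edges_def H_edges_def)

lemma sym_H_edges: "sym H_edges"
proof (rule symI)
  fix a b assume "(a, b) \<in> H_edges"
  then have c: "a \<in> carrier G" "b \<in> carrier G" and h: "inv a \<otimes> b \<in> H" "inv a \<otimes> b \<noteq> \<one>"
    by (auto simp: H_edges_def)
  have "inv b \<otimes> a \<in> H" using subgroup.m_inv_closed[OF subgroup_H h(1)] inv_inv_mult c by simp
  moreover have "inv b \<otimes> a \<noteq> \<one>"
    using h(2) inv_inv_mult[OF c(2,1)] by auto
  ultimately show "(b, a) \<in> H_edges" using c by (simp add: H_edges_def)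
qed

lemma sym_X_edges: "sym X_edges"
  by (auto simp: sym_def X_edges_def)

lemma sym_edges: "sym edges"
  unfolding edges_def by (rule sym_Un[OF sym_X_edges sym_H_edges])

lemma sym_edges_off: "sym (edges_off A)"
  using sym_X_edges sym_H_edges unfolding edges_off_def by (auto simp: sym_def)

lemma edges_off_sub: "edges_off A \<subseteq> edges"
  by (auto simp: edges_off_def edges_def)

lemma edges_outside: "edges - A \<times> A \<subseteq> edges_off A"
  by (auto simp: edges_off_def edges_def)

lemma X_edges_left: "k \<in> carrier G \<Longrightarrow> (a, b) \<in> X_edges \<Longrightarrow> (k \<otimes> a, k \<otimes> b) \<in> X_edges"
proof -
  assume k: "k \<in> carrier G" and "(a, b) \<in> X_edges"
  then obtain s where c: "a \<in> carrier G" "b \<in> carrier G" and s: "s \<in> X" "b = a \<otimes> s \<or> a = b \<otimes> s"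
    by (auto simp: X_edges_def)
  have sc: "s \<in> carrier G" using s(1) X_carrier by blast
  have "k \<otimes> b = (k \<otimes> a) \<otimes> s \<or> k \<otimes> a = (k \<otimes> b) \<otimes> s"
    using s(2) k c sc m_assoc by metis
  then show ?thesis using k c s(1) by (auto simp: X_edges_def)
qed

lemma H_edges_left: "k \<in> carrier G \<Longrightarrow> (a, b) \<in> H_edges \<Longrightarrow> (k \<otimes> a, k \<otimes> b) \<in> H_edges"
  by (auto simp: H_edges_def inv_mult_left)

lemma edges_left: "k \<in> carrier G \<Longrightarrow> (a, b) \<in> edges \<Longrightarrow> (k \<otimes> a, k \<otimes> b) \<in> edges"
  using X_edges_left H_edges_left by (auto simp: edges_def)

lemma mem_l_coset_iff:
  assumes "A \<subseteq> carrier G" "k \<in> carrier G" "a \<in> carrier G"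
  shows "k \<otimes> a \<in> k <# A \<longleftrightarrow> a \<in> A"
  using assms by (auto simp: l_coset_def subset_iff)

lemma edges_off_left:
  assumes "A \<subseteq> carrier G" "k \<in> carrier G" "(a, b) \<in> edges_off A"
  shows "(k \<otimes> a, k \<otimes> b) \<in> edges_off (k <# A)"
proof -
  have "a \<in> carrier G" "b \<in> carrier G" using assms(3) edges_off_sub edges_carrier by blast+
  then show ?thesis
    using assms X_edges_left H_edges_left mem_l_coset_iff by (auto simp: edges_off_def)
qed

lemma H_coset_iff: "a \<in> H \<Longrightarrow> b \<in> carrier G \<Longrightarrow> inv a \<otimes> b \<in> H \<longleftrightarrow> b \<in> H"
  by (metis H_carrier inv_closed inv_solve_left subgroup.m_closed subgroup.m_inv_closed subgroup_H)

lemma reach_generated: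
  assumes "g \<in> generate G (X \<union> H)" and "a \<in> carrier G"
  shows "\<exists>n. (a, a \<otimes> g) \<in> edges ^^ n"
  using assms
proof (induction g arbitrary: a rule: generate.induct)
  case one
  then show ?case by (metis r_one relpow_0_I)
next
  case (incl h)
  show ?case
  proof (cases "h = \<one>")
    case True
    then show ?thesis using incl by (metis r_one relpow_0_I)
  next
    case False
    then have "(a, a \<otimes> h) \<in> edges"
      using incl X_carrier H_carrier by (auto simp: edges_def X_edges_def H_edges_def m_assoc[symmetric])
    then show ?thesis by (metis relpow_1)
  qed
next
  case (inv h)
  have c: "h \<in> carrier G" using inv X_carrier H_carrier by auto
  show ?case
  proof (cases "h = \<one>")
    case True
    then show ?thesis using inv by (metis inv_one r_one relpow_0_I)
  next
    case False
    then have "(a \<otimes> inv h, a) \<in> edges"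
      using inv c by (auto simp: edges_def X_edges_def H_edges_def m_assoc inv_mult_group intro!: bexI[of _ h])
    then show ?thesis using sym_edges by (metis relpow_1 symD)
  qed
next
  case (eng g h)
  have "g \<in> carrier G" "h \<in> carrier G" using eng.hyps generated by auto
  then show ?case using eng.IH(1)[OF eng.prems] eng.IH(2)[of "a \<otimes> g"] eng.prems
    by (metis m_assoc m_closed relpow_concat)
qed

sublocale connected_graph "carrier G" edges
proof
  fix a b assume c: "a \<in> carrier G" "b \<in> carrier G"
  then have "inv a \<otimes> b \<in> generate G (X \<union> H)" using generated by simp
  from reach_generated[OF this c(1)] c show "\<exists>n. (a, b) \<in> edges ^^ n"
    by (simp add: m_assoc[symmetric])
qed (fact edges_carrier sym_edges)+

abbreviation \<Gamma> where "\<Gamma> \<equiv> rel_cayley_graph G H X"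

abbreviation awalk\<^sub>\<Gamma> where "awalk\<^sub>\<Gamma> \<equiv> pre_digraph.awalk \<Gamma>"

lemma verts_\<Gamma>: "verts \<Gamma> = carrier G"
  by (simp add: rel_cayley_graph_def cayley_graph_def)

lemma arc_edge:
  assumes "e \<in> arcs \<Gamma>"
  shows "(tail \<Gamma> e, head \<Gamma> e) \<in> edges"
proof -
  obtain g s fwd where e: "e = (g, s, fwd)" by (cases e)
  have g: "g \<in> carrier G" and s: "s \<in> Inl ` X \<union> Inr ` (H - {\<one>})"
    using assms by (auto simp: e rel_cayley_graph_def cayley_graph_def)
  have "(g, g \<otimes> letter_value s) \<in> edges"
    using g s X_carrier H_carrier
    by (auto simp: edges_def X_edges_def H_edges_def m_assoc[symmetric])
  then show ?thesis using sym_edges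
    by (auto simp: e rel_cayley_graph_def cayley_graph_def dest: symD)
qed

text \<open>
  An edge that is available both as an \<open>X\<close>-edge and as an \<open>H\<close>-edge is represented by the former, so that
  walks off \<open>H\<close> lift to walks that avoid the complete graph on \<open>H\<close>.
\<close>

lemma edge_arc:
  assumes "(a, b) \<in> edges"
  shows "\<exists>e \<in> arcs \<Gamma>. tail \<Gamma> e = a \<and> head \<Gamma> e = b \<and>
           ((a, b) \<in> edges_off H \<longrightarrow> e \<notin> arcs (subgroup_cayley_graph G H))"
proof (cases "(a, b) \<in> X_edges")
  case True
  then obtain s where c: "a \<in> carrier G" "b \<in> carrier G" and s: "s \<in> X" "b = a \<otimes> s \<or> a = b \<otimes> s"
    by (auto simp: X_edges_def)
  from s(2) show ?thesis
  proof
    assume "b = a \<otimes> s"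
    then show ?thesis using c s(1)
      by (intro bexI[of _ "(a, Inl s, True)"])
        (auto simp: rel_cayley_graph_def subgroup_cayley_graph_def cayley_graph_def)
  next
    assume "a = b \<otimes> s"
    then show ?thesis using c s(1)
      by (intro bexI[of _ "(b, Inl s, False)"])
        (auto simp: rel_cayley_graph_def subgroup_cayley_graph_def cayley_graph_def)
  qed
next
  case False
  then have h: "(a, b) \<in> H_edges" using assms by (simp add: edges_def)
  then have c: "a \<in> carrier G" "b \<in> carrier G" "inv a \<otimes> b \<in> H - {\<one>}" by (auto simp: H_edges_def)
  have "a \<otimes> (inv a \<otimes> b) = b" using c by (simp add: m_assoc[symmetric])
  moreover have "a \<notin> H" if "(a, b) \<in> edges_off H"
    using that False h H_coset_iff c by (auto simp: edges_off_def)
  ultimately show ?thesis using c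
    by (intro bexI[of _ "(a, Inr (inv a \<otimes> b), True)"])
      (auto simp: rel_cayley_graph_def subgroup_cayley_graph_def cayley_graph_def)
qed

lemma awalk_relpow:
  assumes "awalk\<^sub>\<Gamma> u p v"
  shows "(u, v) \<in> edges ^^ length p"
  using assms
proof (induction p arbitrary: u)
  case Nil
  then show ?case by (simp add: pre_digraph.awalk_def pre_digraph.cas.simps)
next
  case (Cons e p)
  have e: "(tail \<Gamma> e, head \<Gamma> e) \<in> edges" "tail \<Gamma> e = u"
    using Cons.prems by (auto simp: pre_digraph.awalk_def pre_digraph.cas.simps arc_edge)
  moreover have "awalk\<^sub>\<Gamma> (head \<Gamma> e) p v"
    using Cons.prems e edges_carrier by (auto simp: pre_digraph.awalk_def pre_digraph.cas.simps verts_\<Gamma>)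
  ultimately show ?case using Cons.IH by (metis length_Cons relpow_Suc_I2)
qed

lemma chain_awalk:
  assumes "c 0 \<in> carrier G" and "\<And>i. i < n \<Longrightarrow> (c i, c (Suc i)) \<in> edges"
  shows "\<exists>p. length p = n \<and> awalk\<^sub>\<Gamma> (c 0) p (c n) \<and>
           pre_digraph.awalk_verts \<Gamma> (c 0) p = map c [0..<Suc n] \<and>
           ((\<forall>i<n. (c i, c (Suc i)) \<in> edges_off H) \<longrightarrow>
             set p \<inter> arcs (subgroup_cayley_graph G H) = {})"
  using assms
proof (induction n arbitrary: c)
  case 0
  then show ?case
    by (simp add: pre_digraph.awalk_def pre_digraph.cas.simps verts_\<Gamma> pre_digraph.awalk_verts.simps)
next
  case (Suc n)
  obtain e where e: "e \<in> arcs \<Gamma>" "tail \<Gamma> e = c 0" "head \<Gamma> e = c 1"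
      "(c 0, c 1) \<in> edges_off H \<longrightarrow> e \<notin> arcs (subgroup_cayley_graph G H)"
    using edge_arc[of "c 0" "c 1"] Suc.prems(2)[of 0] by auto
  have c1: "c 1 \<in> carrier G" using Suc.prems(2)[of 0] edges_carrier by auto
  have "(c (Suc i), c (Suc (Suc i))) \<in> edges" if "i < n" for i
    using Suc.prems(2)[of "Suc i"] that by simp
  note IH = Suc.IH[of "\<lambda>i. c (Suc i)", OF c1[unfolded One_nat_def] this]
  obtain p where p: "length p = n" "awalk\<^sub>\<Gamma> (c 1) p (c (Suc n))"
      "pre_digraph.awalk_verts \<Gamma> (c 1) p = map (\<lambda>i. c (Suc i)) [0..<Suc n]"
      "(\<forall>i<n. (c (Suc i), c (Suc (Suc i))) \<in> edges_off H) \<longrightarrow>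
         set p \<inter> arcs (subgroup_cayley_graph G H) = {}"
    using IH unfolding One_nat_def by blast
  have "map c [0..<Suc (Suc n)] = c 0 # map (\<lambda>i. c (Suc i)) [0..<Suc n]"
    by (rule nth_equalityI) (simp_all add: nth_Cons split: nat.split del: upt_Suc)
  then have "pre_digraph.awalk_verts \<Gamma> (c 0) (e # p) = map c [0..<Suc (Suc n)]"
    using p(3) e(2,3) by (simp only: pre_digraph.awalk_verts.simps)
  moreover have "awalk\<^sub>\<Gamma> (c 0) (e # p) (c (Suc n))"
    using p(2) e(1-3) Suc.prems(1) by (simp add: pre_digraph.awalk_def pre_digraph.cas.simps verts_\<Gamma>)
  moreover have "set (e # p) \<inter> arcs (subgroup_cayley_graph G H) = {}"
    if off: "\<forall>i<Suc n. (c i, c (Suc i)) \<in> edges_off H"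
  proof -
    have "set p \<inter> arcs (subgroup_cayley_graph G H) = {}" using p(4) off by blast
    moreover have "(c 0, c 1) \<in> edges_off H" using off by auto
    ultimately show ?thesis using e(4) by simp
  qed
  moreover have "length (e # p) = Suc n" using p(1) by simp
  ultimately show ?case by blast
qed

lemma graph_dist_hops:
  assumes "a \<in> carrier G" "b \<in> carrier G"
  shows "graph_dist \<Gamma> a b = enat (dst a b)"
proof (rule antisym)
  obtain c where "geo c a b" using geo_ex[OF assms] by blast
  then have c: "c 0 = a" "c (dst a b) = b" "\<And>i. i < dst a b \<Longrightarrow> (c i, c (Suc i)) \<in> edges"
    by (simp_all add: geo_def)
  have "c 0 \<in> carrier G" using c(1) assms(1) by simp
  from chain_awalk[of c "dst a b", OF this c(3)] obtain p where "length p = dst a b" "awalk\<^sub>\<Gamma> a p b"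
    unfolding c(1,2) by blast
  then show "graph_dist \<Gamma> a b \<le> enat (dst a b)"
    unfolding graph_dist_def by (metis INF_lower mem_Collect_eq)
  show "enat (dst a b) \<le> graph_dist \<Gamma> a b"
    unfolding graph_dist_def by (rule INF_greatest) (auto intro: hops_le dest: awalk_relpow)
qed

lemma geo_geodesic:
  assumes "geo \<gamma> a b" "a \<in> carrier G" "b \<in> carrier G"
  shows "\<exists>p. geodesic \<Gamma> a p b \<and> set (pre_digraph.awalk_verts \<Gamma> a p) = \<gamma> ` {..dst a b}"
proof -
  have c: "\<gamma> 0 = a" "\<gamma> (dst a b) = b" "\<And>i. i < dst a b \<Longrightarrow> (\<gamma> i, \<gamma> (Suc i)) \<in> edges"
    using assms(1) by (simp_all add: geo_def)
  have "\<gamma> 0 \<in> carrier G" using c(1) assms(2) by simp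
  from chain_awalk[of \<gamma> "dst a b", OF this c(3)] obtain p where "length p = dst a b" "awalk\<^sub>\<Gamma> a p b"
      "pre_digraph.awalk_verts \<Gamma> a p = map \<gamma> [0..<Suc (dst a b)]"
    unfolding c(1,2) by blast
  moreover have "{0..<Suc n} = {..n}" for n by auto
  ultimately show ?thesis
    using graph_dist_hops[OF assms(2,3)]
    by (intro exI[of _ p]) (simp add: geodesic_def del: upt_Suc)
qed

lemma dst_left:
  assumes "k \<in> carrier G" "a \<in> carrier G" "b \<in> carrier G"
  shows "dst (k \<otimes> a) (k \<otimes> b) = dst a b"
proof -
  have le: "dst (k \<otimes> a) (k \<otimes> b) \<le> dst a b"
    if "k \<in> carrier G" "a \<in> carrier G" "b \<in> carrier G" for k a b
    by (rule hops_le[OF relpow_hom[where \<phi> = "(\<otimes>) k", OF hops_walk[OF that(2,3)] edges_left[OF that(1)]]])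
  show ?thesis using le[OF assms] le[of "inv k" "k \<otimes> a" "k \<otimes> b"] assms
    by (simp add: m_assoc[symmetric])
qed

lemma cdst_left:
  assumes "k \<in> carrier G" "A \<subseteq> carrier G" "f \<in> carrier G"
  shows "cdst (k <# A) (k \<otimes> f) = cdst A f"
proof -
  have "(\<exists>a\<in>k <# A. dst (k \<otimes> f) a = n) \<longleftrightarrow> (\<exists>a\<in>A. dst f a = n)" for n
    using assms by (auto simp: l_coset_def dst_left subset_iff)
  then show ?thesis by (simp add: cdst_def)
qed

lemma proj_left:
  assumes "k \<in> carrier G" "A \<subseteq> carrier G" "f \<in> carrier G"
  shows "proj (k <# A) (k \<otimes> f) = (\<otimes>) k ` proj A f"
proof -
  have "a \<in> carrier G" if "a \<in> A" for a using that assms by blast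
  then show ?thesis
    unfolding proj_def cdst_left[OF assms] using assms
    by (auto simp: l_coset_def dst_left)
qed

definition cosets :: "'a set set"
  where "cosets = (\<lambda>a. a <# H) ` carrier G"

lemma coset_eq:
  assumes "A \<in> cosets" "u \<in> A"
  shows "A = u <# H"
proof -
  obtain a where "a \<in> carrier G" "A = a <# H" using assms(1) by (auto simp: cosets_def)
  then show ?thesis using l_repr_independence[OF _ _ subgroup_H] assms(2) by simp
qed

lemma coset_carrier: "A \<in> cosets \<Longrightarrow> A \<subseteq> carrier G"
  using l_coset_subset_G[OF subgroup.subset[OF subgroup_H]] by (auto simp: cosets_def)

lemma coset_mem_iff:
  assumes "A \<in> cosets" "u \<in> A" "v \<in> carrier G"
  shows "v \<in> A \<longleftrightarrow> inv u \<otimes> v \<in> H"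
proof -
  have u: "u \<in> carrier G" using assms coset_carrier by blast
  then have "v \<in> u <# H \<longleftrightarrow> inv u \<otimes> v \<in> H"
    using assms(3) H_carrier by (auto simp: l_coset_def m_assoc[symmetric] intro!: bexI[of _ "inv u \<otimes> v"])
  then show ?thesis using coset_eq[OF assms(1,2)] by simp
qed

lemma coset_diff: "A \<in> cosets \<Longrightarrow> u \<in> A \<Longrightarrow> v \<in> A \<Longrightarrow> inv u \<otimes> v \<in> H"
  using coset_mem_iff coset_carrier by blast

lemma coset_disjoint: "A \<in> cosets \<Longrightarrow> B \<in> cosets \<Longrightarrow> A \<inter> B \<noteq> {} \<Longrightarrow> A = B"
  using coset_eq by blast

lemma coset_left: "A \<in> cosets \<Longrightarrow> k \<in> carrier G \<Longrightarrow> k <# A \<in> cosets"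
  using lcos_m_assoc[OF subgroup.subset[OF subgroup_H]] by (auto simp: cosets_def)

lemma H_coset: "H \<in> cosets"
  using lcos_mult_one[OF subgroup.subset[OF subgroup_H]] one_closed unfolding cosets_def by (metis image_eqI)

lemma coset_to_H: "A \<in> cosets \<Longrightarrow> u \<in> A \<Longrightarrow> inv u <# A = H"
  using coset_eq[of A u] coset_carrier[of A] lcos_m_assoc[OF subgroup.subset[OF subgroup_H], of "inv u" u]
    lcos_mult_one[OF subgroup.subset[OF subgroup_H]] by (metis inv_closed l_inv subsetD)

lemma coset_hops: "A \<in> cosets \<Longrightarrow> u \<in> A \<Longrightarrow> v \<in> A \<Longrightarrow> dst u v \<le> 1"
proof -
  assume A: "A \<in> cosets" "u \<in> A" "v \<in> A"
  then have c: "u \<in> carrier G" "v \<in> carrier G" using coset_carrier by auto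
  show "dst u v \<le> 1"
  proof (cases "u = v")
    case False
    then have "inv u \<otimes> v \<noteq> \<one>" using c by (metis inv_inv inv_solve_left' one_closed r_one inv_closed)
    then have "(u, v) \<in> edges" using coset_diff[OF A] c by (simp add: edges_def H_edges_def)
    then show ?thesis by (metis hops_le relpow_1)
  qed simp
qed

lemma coset_clique: "A \<in> cosets \<Longrightarrow> clique A"
  unfolding clique_def using coset_carrier coset_hops subgroup.one_closed[OF subgroup_H]
  by (auto simp: cosets_def l_coset_def)

text \<open>
  The ball about \<open>\<one>\<close> for \<^const>\<open>rel_dist\<close>, in terms of vertices only. The relative distance between two
  points \<open>u, v\<close> of a coset is then measured by the element \<open>inv u \<otimes> v\<close> of \<open>H\<close>.
\<close>

definition rel_ball :: "nat \<Rightarrow> 'a set"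
  where "rel_ball n = {h \<in> H. \<exists>m \<le> n. (\<one>, h) \<in> edges_off H ^^ m}"

lemma edges_off_H_left: "h \<in> H \<Longrightarrow> (a, b) \<in> edges_off H ^^ n \<Longrightarrow> (h \<otimes> a, h \<otimes> b) \<in> edges_off H ^^ n"
proof (erule relpow_hom)
  fix x y assume h: "h \<in> H" and xy: "(x, y) \<in> edges_off H"
  have "h <# H = H" using coset_eq[OF H_coset h] by simp
  then show "(h \<otimes> x, h \<otimes> y) \<in> edges_off H"
    using edges_off_left[OF subgroup.subset[OF subgroup_H] _ xy, of h] H_carrier h by simp
qed

lemma rel_ball_H: "rel_ball n \<subseteq> H"
  by (auto simp: rel_ball_def)

lemma rel_ball_mono: "m \<le> n \<Longrightarrow> rel_ball m \<subseteq> rel_ball n"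
  unfolding rel_ball_def using le_trans by blast

lemma one_rel_ball: "\<one> \<in> rel_ball n"
  unfolding rel_ball_def using subgroup.one_closed[OF subgroup_H]
  by (auto intro!: exI[of _ 0])

lemma rel_ball_inv: "h \<in> rel_ball n \<Longrightarrow> inv h \<in> rel_ball n"
proof -
  assume "h \<in> rel_ball n"
  then obtain m where h: "h \<in> H" and m: "m \<le> n" "(\<one>, h) \<in> edges_off H ^^ m"
    by (auto simp: rel_ball_def)
  have i: "inv h \<in> H" using subgroup.m_inv_closed[OF subgroup_H h] .
  have "(inv h, \<one>) \<in> edges_off H ^^ m"
    using edges_off_H_left[OF i m(2)] h i H_carrier by simp
  then have "(\<one>, inv h) \<in> edges_off H ^^ m" using sym_relpow[OF sym_edges_off] by (meson symD)
  with i m(1) show ?thesis by (auto simp: rel_ball_def)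
qed

lemma rel_ball_mult:
  assumes "h \<in> rel_ball m" "k \<in> rel_ball n"
  shows "h \<otimes> k \<in> rel_ball (m + n)"
proof -
  obtain i j where h: "h \<in> H" "i \<le> m" "(\<one>, h) \<in> edges_off H ^^ i"
    and k: "k \<in> H" "j \<le> n" "(\<one>, k) \<in> edges_off H ^^ j"
    using assms by (auto simp: rel_ball_def)
  have "(\<one>, h \<otimes> k) \<in> edges_off H ^^ (i + j)"
    using relpow_concat[OF h(3)] edges_off_H_left[OF h(1) k(3)] H_carrier h(1) by simp
  then show ?thesis using h k subgroup.m_closed[OF subgroup_H]
    unfolding rel_ball_def by (auto intro!: exI[of _ "i + j"])
qed

lemma rel_ball_rel_dist:
  assumes "h \<in> rel_ball n"
  shows "rel_dist G H X \<one> h \<le> enat n"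
proof -
  obtain m where m: "m \<le> n" "(\<one>, h) \<in> edges_off H ^^ m" using assms by (auto simp: rel_ball_def)
  then obtain c where c: "c 0 = \<one>" "c m = h" "\<And>i. i < m \<Longrightarrow> (c i, c (Suc i)) \<in> edges_off H"
    unfolding relpow_fun_conv by blast
  then obtain p where p: "length p = m" "awalk\<^sub>\<Gamma> \<one> p h"
      "set p \<inter> arcs (subgroup_cayley_graph G H) = {}"
    using chain_awalk[of c m] edges_off_sub by (metis one_closed subsetD)
  then have "rel_dist G H X \<one> h \<le> enat (length p)"
    unfolding rel_dist_def by (intro INF_lower) simp
  with p(1) m(1) show ?thesis by (metis enat_ord_simps(1) order_trans)
qed

end

section \<open>Separating cosets\<close>

locale hyperbolic_embedding = relative_cayley +
  assumes hyperbolic: "gromov_hyperbolic (rel_cayley_graph G H X)"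
    and locally_finite: "h \<in> H \<Longrightarrow> finite {k \<in> H. rel_dist G H X h k \<le> enat n}"
begin

lemma finite_rel_ball: "finite (rel_ball n)"
  by (rule finite_subset[OF _ locally_finite[of \<one> n]])
    (use rel_ball_H rel_ball_rel_dist subgroup.one_closed[OF subgroup_H] in auto)

lemma slim_ex: "\<exists>\<delta>. slim_graph (carrier G) edges \<delta>"
proof -
  obtain \<delta> where \<delta>: "\<And>x y z p q r w. geodesic \<Gamma> x p y \<Longrightarrow> geodesic \<Gamma> y q z \<Longrightarrow> geodesic \<Gamma> z r x \<Longrightarrow>
      w \<in> set (pre_digraph.awalk_verts \<Gamma> x p) \<Longrightarrow>
      \<exists>w' \<in> set (pre_digraph.awalk_verts \<Gamma> y q) \<union> set (pre_digraph.awalk_verts \<Gamma> z r).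
        graph_dist \<Gamma> w w' \<le> enat \<delta>"
    using hyperbolic unfolding gromov_hyperbolic_def by meson
  have "(\<exists>j \<le> dst y z. dst (p i) (q j) \<le> \<delta>) \<or> (\<exists>j \<le> dst z x. dst (p i) (r j) \<le> \<delta>)"
    if V: "x \<in> carrier G" "y \<in> carrier G" "z \<in> carrier G"
      and g: "geo p x y" "geo q y z" "geo r z x" and i: "i \<le> dst x y" for x y z p q r i
  proof -
    obtain p' where p': "geodesic \<Gamma> x p' y" "set (pre_digraph.awalk_verts \<Gamma> x p') = p ` {..dst x y}"
      using geo_geodesic[OF g(1) V(1,2)] by blast
    obtain q' where q': "geodesic \<Gamma> y q' z" "set (pre_digraph.awalk_verts \<Gamma> y q') = q ` {..dst y z}"
      using geo_geodesic[OF g(2) V(2,3)] by blast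
    obtain r' where r': "geodesic \<Gamma> z r' x" "set (pre_digraph.awalk_verts \<Gamma> z r') = r ` {..dst z x}"
      using geo_geodesic[OF g(3) V(3,1)] by blast
    obtain w' where w': "w' \<in> q ` {..dst y z} \<union> r ` {..dst z x}" "graph_dist \<Gamma> (p i) w' \<le> enat \<delta>"
      using \<delta>[OF p'(1) q'(1) r'(1), of "p i"] p'(2) q'(2) r'(2) i by auto
    have "w' \<in> carrier G" using w'(1) geo_verts[OF g(2) V(2)] geo_verts[OF g(3) V(3)] by auto
    then have "dst (p i) w' \<le> \<delta>"
      using w'(2) graph_dist_hops geo_verts[OF g(1) V(1) i] by simp
    then show ?thesis using w'(1) by auto
  qed
  then have "slim_graph_axioms (carrier G) edges \<delta>" by unfold_locales blast
  then show ?thesis using connected_graph_axioms by (auto intro: slim_graph.intro)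
qed

definition \<delta> :: nat
  where "\<delta> = (SOME \<delta>. slim_graph (carrier G) edges \<delta>)"

sublocale slim_graph "carrier G" edges \<delta>
  unfolding \<delta>_def by (rule someI_ex[OF slim_ex])

text \<open>
  The bound of \<open>isolated_clique_bound\<close>.
\<close>

definition D :: nat
  where "D = 16 * \<delta> + 5"

text \<open>
  A geodesic without a step inside \<open>A\<close> uses no \<open>H\<close>-edge of \<open>A\<close>, so it would give a short bypass between
  \<open>u\<close> and \<open>v\<close>; translating by \<open>inv u\<close> moves that bypass to \<open>H\<close>.
\<close>

lemma far_proj_crosses:
  assumes A: "A \<in> cosets" and V: "f \<in> carrier G" "g \<in> carrier G"
    and u: "u \<in> proj A f" and v: "v \<in> proj A g" and far: "inv u \<otimes> v \<notin> rel_ball D"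
  shows "crosses A f g"
proof (rule ccontr)
  assume "\<not> crosses A f g"
  then obtain \<gamma> where g: "geo \<gamma> f g" and "\<And>i. i < dst f g \<Longrightarrow> \<gamma> i \<in> A \<Longrightarrow> \<gamma> (Suc i) \<notin> A"
    unfolding crosses_def by blast
  then have "(\<gamma> i, \<gamma> (Suc i)) \<in> edges_off A" if "i < dst f g" for i
    using that edges_outside[of A] unfolding geo_def by blast
  then obtain n where n: "n \<le> D" "(u, v) \<in> edges_off A ^^ n"
    using isolated_clique_bound[OF edges_outside sym_edges_off coset_clique[OF A] V u v g _ edges_off_sub]
    unfolding D_def by blast
  have uA: "u \<in> A" "v \<in> A" using u v by (auto simp: proj_def)
  then have c: "u \<in> carrier G" using coset_carrier[OF A] by blast
  have "(inv u \<otimes> u, inv u \<otimes> v) \<in> edges_off (inv u <# A) ^^ n"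
    using c by (intro relpow_hom[where \<phi> = "(\<otimes>) (inv u)", OF n(2)] edges_off_left[OF coset_carrier[OF A]]) auto
  then have "inv u \<otimes> v \<in> rel_ball D"
    using n(1) c coset_to_H[OF A uA(1)] coset_diff[OF A uA] by (auto simp: rel_ball_def)
  with far show False by contradiction
qed

text \<open>
  The constant geodesic at \<open>f\<close> crosses nothing.
\<close>

lemma proj_diff_rel_ball:
  assumes "A \<in> cosets" "f \<in> carrier G" "u \<in> proj A f" "v \<in> proj A f"
  shows "inv u \<otimes> v \<in> rel_ball D"
  using far_proj_crosses[OF assms(1,2,2,3,4)] crosses_hops[OF _ coset_clique[OF assms(1)] assms(2,2)]
  by auto

lemma finite_proj:
  assumes "A \<in> cosets" "f \<in> carrier G"
  shows "finite (proj A f)"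
proof (cases "proj A f = {}")
  case False
  then obtain u where u: "u \<in> proj A f" by blast
  have c: "proj A f \<subseteq> carrier G" using proj_sub coset_carrier[OF assms(1)] by blast
  have "v \<in> (\<otimes>) u ` rel_ball D" if "v \<in> proj A f" for v
  proof -
    have "v = u \<otimes> (inv u \<otimes> v)" using c u that by (auto simp: m_assoc[symmetric] subset_iff)
    then show ?thesis using proj_diff_rel_ball[OF assms u that] by blast
  qed
  then show ?thesis using finite_rel_ball finite_subset by (metis finite_imageI subsetI)
qed simp

definition separators :: "'a \<Rightarrow> 'a \<Rightarrow> 'a set set"
  where "separators f g =
    {A \<in> cosets. \<exists>u \<in> proj A f. \<exists>v \<in> proj A g. inv u \<otimes> v \<notin> rel_ball D}"

lemma separators_coset: "A \<in> separators f g \<Longrightarrow> A \<in> cosets"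
  by (simp add: separators_def)

lemma separators_cross: "f \<in> carrier G \<Longrightarrow> g \<in> carrier G \<Longrightarrow> A \<in> separators f g \<Longrightarrow> crosses A f g"
  using far_proj_crosses by (auto simp: separators_def)

lemma proj_carrier: "A \<in> cosets \<Longrightarrow> u \<in> proj A f \<Longrightarrow> u \<in> carrier G"
  using coset_carrier proj_sub by blast

lemma separators_sym: "separators f g = separators g f"
proof -
  have "separators f g \<subseteq> separators g f" for f g
    unfolding separators_def using rel_ball_inv inv_inv_mult proj_carrier by (smt (verit) mem_Collect_eq subsetI)
  then show ?thesis by blast
qed

text \<open>
  Separators of two points are linearly ordered by their distance from one of the points. This makes
  them finite in number, and makes it meaningful to speak of the last one.
\<close>

lemma separators_position:
  assumes "A \<in> separators f g" "B \<in> separators f g" "f \<in> carrier G" "g \<in> carrier G"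
    and "cdst A f = cdst B f"
  shows "A = B"
  using crosses_same_position[OF separators_cross separators_cross] assms
    coset_disjoint separators_coset coset_clique by metis

lemma finite_separators:
  assumes "f \<in> carrier G" "g \<in> carrier G"
  shows "finite (separators f g)"
proof (rule inj_on_finite)
  show "inj_on (\<lambda>A. cdst A f) (separators f g)"
    using separators_position assms by (auto intro!: inj_onI)
  show "(\<lambda>A. cdst A f) ` separators f g \<subseteq> {..dst f g}"
    using crosses_hops[OF separators_cross coset_clique[OF separators_coset]] assms by fastforce
qed simp

lemma separators_left:
  assumes "k \<in> carrier G" "f \<in> carrier G" "g \<in> carrier G"
  shows "separators (k \<otimes> f) (k \<otimes> g) = (<#) k ` separators f g"
proof -
  have sub: "(<#) k ` separators f g \<subseteq> separators (k \<otimes> f) (k \<otimes> g)"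
    if c: "k \<in> carrier G" "f \<in> carrier G" "g \<in> carrier G" for k f g
  proof (rule image_subsetI)
    fix A assume A: "A \<in> separators f g"
    then obtain u v where uv: "u \<in> proj A f" "v \<in> proj A g" "inv u \<otimes> v \<notin> rel_ball D"
      by (auto simp: separators_def)
    note cA = separators_coset[OF A]
    have "k \<otimes> u \<in> proj (k <# A) (k \<otimes> f)" "k \<otimes> v \<in> proj (k <# A) (k \<otimes> g)"
      using uv c by (auto simp: proj_left[OF c(1) coset_carrier[OF cA]])
    moreover have "inv (k \<otimes> u) \<otimes> (k \<otimes> v) \<notin> rel_ball D"
      using uv inv_mult_left c proj_carrier[OF cA] by metis
    ultimately show "k <# A \<in> separators (k \<otimes> f) (k \<otimes> g)"
      using coset_left[OF cA c(1)] unfolding separators_def by blast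
  qed
  moreover have "separators (k \<otimes> f) (k \<otimes> g) \<subseteq> (<#) k ` separators f g"
  proof
    fix A assume A: "A \<in> separators (k \<otimes> f) (k \<otimes> g)"
    have "A = k <# (inv k <# A)"
      using coset_carrier[OF separators_coset[OF A]] assms(1) by (simp add: lcos_m_assoc lcos_mult_one)
    moreover have "inv k <# A \<in> separators f g"
      using sub[of "inv k" "k \<otimes> f" "k \<otimes> g"] A assms by (auto simp: m_assoc[symmetric])
    ultimately show "A \<in> (<#) k ` separators f g" by blast
  qed
  ultimately show ?thesis using sub[OF assms] by blast
qed

text \<open>
  The cosets that separate \<open>f\<close> from both \<open>g\<close> and \<open>h\<close> and through which the ways to \<open>g\<close> and to \<open>h\<close> leave
  differently.
\<close>

definition branching :: "'a \<Rightarrow> 'a \<Rightarrow> 'a \<Rightarrow> 'a set set"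
  where "branching f g h = {A \<in> separators f g \<inter> separators f h. proj A g \<noteq> proj A h}"

text \<open>
  Of two common separators of \<open>f\<close> from \<open>g\<close> and \<open>h\<close>, the one nearer to \<open>f\<close> has the same projections of \<open>g\<close>
  and \<open>h\<close>, so only the last can be a branching coset.
\<close>

lemma branching_at_most_one:
  assumes c: "f \<in> carrier G" "g \<in> carrier G" "h \<in> carrier G"
  shows "finite (branching f g h)" and "card (branching f g h) \<le> 1"
proof -
  show fin: "finite (branching f g h)"
    using finite_separators[OF c(1,2)] by (simp add: branching_def)
  have not_less: "\<not> cdst A f < cdst B f" if "A \<in> branching f g h" "B \<in> branching f g h" for A B
    using that proj_eq_if_later_crossing[of A f g h B] separators_cross separators_coset coset_clique c
    by (auto simp: branching_def)
  then have "A = B" if "A \<in> branching f g h" "B \<in> branching f g h" for A B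
    using that separators_position[of A f g B] c by (metis (no_types, lifting) Int_iff branching_def
        linorder_neqE_nat mem_Collect_eq)
  then show "card (branching f g h) \<le> 1"
    using card_le_Suc0_iff_eq[OF fin] by auto
qed

end

section \<open>Averages in normed modules\<close>

context normed_space_over
begin

lemma F_add: "a \<in> F \<Longrightarrow> b \<in> F \<Longrightarrow> a + b \<in> F"
  and F_one: "1 \<in> F"
  and F_zero: "0 \<in> F"
  using subringE[OF subcring.axioms(1)[OF subdomain.axioms(1)[OF subfield.axioms(1)[OF subfield]]]]
  by (auto simp: complex_ring_def)

lemma F_inverse:
  assumes "a \<in> F"
  shows "inverse a \<in> F"
proof (cases "a = 0")
  case False
  then have "a \<in> Units (complex_ring\<lparr>carrier := F\<rparr>)"
    using assms subfield.subfield_Units[OF subfield] by (simp add: complex_ring_def)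
  then obtain b where "b \<in> F" "b * a = 1" by (auto simp: Units_def complex_ring_def)
  then show ?thesis using inverse_unique[of a b] by (simp add: mult.commute)
qed (simp add: F_zero)

lemma F_of_nat: "of_nat n \<in> F"
  by (induction n) (auto simp: F_zero F_one F_add)

lemma F_weight: "1 / of_nat n \<in> F"
  using F_inverse[OF F_of_nat] by (simp add: inverse_eq_divide)

lemma scale_zero_right: "a \<in> F \<Longrightarrow> scale a 0 = 0"
  using scale_right_distrib[of a 0 0] by simp

lemma scale_zero_left: "scale 0 x = 0"
  using scale_left_distrib[OF F_zero F_zero, of x] by simp

lemma scale_minus_right: "a \<in> F \<Longrightarrow> scale a (- x) = - scale a x"
  using scale_right_distrib[of a x "- x"] by (simp add: scale_zero_right eq_neg_iff_add_eq_0 add.commute)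

lemma scale_sum: "a \<in> F \<Longrightarrow> scale a (sum f S) = (\<Sum>x\<in>S. scale a (f x))"
  by (induction S rule: infinite_finite_induct) (auto simp: scale_zero_right scale_right_distrib)

lemma scale_of_nat: "scale (of_nat n) x = (\<Sum>i<n. x)"
  by (induction n) (auto simp: scale_zero_left scale_left_distrib F_one F_of_nat scale_one add.commute)

lemma nrm_zero: "nrm 0 = 0"
  using nrm_eq_zero_iff by simp

lemma F_minus_one: "- 1 \<in> F"
proof -
  have "a_inv complex_ring 1 \<in> F"
    using subringE(5)[OF subcring.axioms(1)[OF subdomain.axioms(1)[OF subfield.axioms(1)[OF subfield]]]] F_one by simp
  moreover have "a_inv complex_ring 1 = -1"
    by (auto simp: a_inv_def m_inv_def complex_ring_def intro!: the_equality)
      (metis add.commute add_eq_0_iff)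
  ultimately show ?thesis by simp
qed

lemma nrm_minus: "nrm (- x) = nrm x"
proof -
  have "scale (- 1) x + x = 0"
    using scale_left_distrib[OF F_minus_one F_one, of x] by (simp add: scale_zero_left scale_one)
  then have "scale (- 1) x = - x" by (simp add: eq_neg_iff_add_eq_0)
  then show ?thesis using nrm_scale[OF F_minus_one, of x] by simp
qed

lemma nrm_diff: "nrm (x - y) \<le> nrm x + nrm y"
  using nrm_triangle[of x "- y"] by (simp add: nrm_minus)

lemma nrm_sum: "(\<And>x. x \<in> S \<Longrightarrow> nrm (f x) \<le> e) \<Longrightarrow> nrm (sum f S) \<le> real (card S) * e"
proof (induction S rule: infinite_finite_induct)
  case (insert x S)
  then show ?case using nrm_triangle[of "f x" "sum f S"] by (fastforce simp: algebra_simps)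
qed (auto simp: nrm_zero)

lemma nrm_diff4: "nrm (a - b - c - d) \<le> nrm a + nrm b + nrm c + nrm d"
  using nrm_diff[of "a - b - c" d] nrm_diff[of "a - b" c] nrm_diff[of a b] by linarith

definition avg :: "'b set \<Rightarrow> ('b \<Rightarrow> 'v) \<Rightarrow> 'v"
  where "avg S f = scale (1 / of_nat (card S)) (sum f S)"

lemma avg_cong: "(\<And>x. x \<in> S \<Longrightarrow> f x = g x) \<Longrightarrow> avg S f = avg S g"
  unfolding avg_def by (metis sum.cong)

lemma avg_zero: "(\<And>x. x \<in> S \<Longrightarrow> f x = 0) \<Longrightarrow> avg S f = 0"
  by (simp add: avg_def scale_zero_right[OF F_weight])

lemma avg_add: "avg S (\<lambda>x. f x + g x) = avg S f + avg S g"
  by (simp add: avg_def sum.distrib scale_right_distrib[OF F_weight])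

lemma avg_minus: "avg S (\<lambda>x. - f x) = - avg S f"
  by (simp add: avg_def sum_negf scale_minus_right[OF F_weight])

lemma avg_scale: "a \<in> F \<Longrightarrow> avg S (\<lambda>x. scale a (f x)) = scale a (avg S f)"
  by (simp add: avg_def scale_sum[symmetric] scale_scale[OF F_weight] scale_scale[OF _ F_weight] mult.commute)

lemma avg_const:
  assumes "finite S" "S \<noteq> {}"
  shows "avg S (\<lambda>_. c) = c"
proof -
  have n: "card S \<noteq> 0" using assms by simp
  obtain h where h: "bij_betw h {..<card S} S"
    using ex_bij_betw_nat_finite[OF assms(1)] by (auto simp: atLeast0LessThan)
  have "(\<Sum>x\<in>S. c) = scale (of_nat (card S)) c"
    using sum.reindex_bij_betw[OF h, of "\<lambda>_. c"] by (simp add: scale_of_nat)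
  then show ?thesis using n
    by (simp add: avg_def scale_scale[OF F_weight F_of_nat] scale_one)
qed

lemma avg_avg:
  "avg S (\<lambda>x. avg T (f x)) = scale (1 / of_nat (card S * card T)) (\<Sum>x\<in>S. \<Sum>y\<in>T. f x y)"
  unfolding avg_def by (simp add: scale_sum[OF F_weight, symmetric] scale_scale[OF F_weight F_weight])

lemma avg_swap: "avg S (\<lambda>x. avg T (f x)) = avg T (\<lambda>y. avg S (\<lambda>x. f x y))"
  unfolding avg_avg by (subst sum.swap) (simp add: mult.commute)

lemma avg_norm_le:
  assumes "finite S" "S \<noteq> {}" and "\<And>x. x \<in> S \<Longrightarrow> nrm (f x) \<le> e"
  shows "nrm (avg S f) \<le> e"
proof -
  have "nrm (avg S f) = nrm (sum f S) / card S"
    using nrm_scale[OF F_weight] by (simp add: avg_def norm_divide)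
  also have "\<dots> \<le> e"
    using nrm_sum[of S f e] assms by (simp add: divide_le_eq card_gt_0_iff mult.commute)
  finally show ?thesis .
qed

lemma avg_reindex: "inj_on k S \<Longrightarrow> avg (k ` S) f = avg S (\<lambda>x. f (k x))"
  by (simp add: avg_def card_image sum.reindex)

end

context normed_module
begin

lemma act_mult: "g \<in> carrier G \<Longrightarrow> h \<in> carrier G \<Longrightarrow> act (g \<otimes>\<^bsub>G\<^esub> h) x = act g (act h x)"
  using composition_rule by simp

lemma act_one: "act \<one>\<^bsub>G\<^esub> x = x"
  using id_eq_one by (metis UNIV_I restrict_apply')

lemma act_zero: "g \<in> carrier G \<Longrightarrow> act g 0 = 0"
  using act_add[of g 0 0] by simp

lemma act_minus: "g \<in> carrier G \<Longrightarrow> act g (- x) = - act g x"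
  using act_add[of g x "- x"] by (simp add: act_zero eq_neg_iff_add_eq_0 add.commute)

lemma act_diff: "g \<in> carrier G \<Longrightarrow> act g (x - y) = act g x - act g y"
  using act_add[of g x "- y"] by (simp add: act_minus)

lemma act_sum: "g \<in> carrier G \<Longrightarrow> act g (sum f S) = (\<Sum>x\<in>S. act g (f x))"
  by (induction S rule: infinite_finite_induct) (auto simp: act_zero act_add)

lemma act_avg: "g \<in> carrier G \<Longrightarrow> act g (avg S f) = avg S (\<lambda>x. act g (f x))"
  by (simp add: avg_def act_scale F_weight act_sum)

end

section \<open>Summing over separating cosets\<close>

locale coset_averaging =
  hyperbolic_embedding G H X + normed_module F scale nrm G act
  for G :: "('g, 'm) monoid_scheme" (structure) and H X :: "'g set" and F :: "complex set"
    and scale :: "complex \<Rightarrow> 'v::ab_group_add \<Rightarrow> 'v" and nrm :: "'v \<Rightarrow> real"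
    and act :: "'g \<Rightarrow> 'v \<Rightarrow> 'v"
begin

text \<open>
  Discarding the values on a finite ball keeps \<open>q\<close> within bounded distance and leaves in the sum below
  only cosets whose projections are far apart. The radius is twice \<open>D\<close> so that, by the triangle
  inequality, a coset that contributes to one side of a triangle still separates the ends of a second side.
\<close>

definition truncated :: "('g \<Rightarrow> 'v) \<Rightarrow> 'g \<Rightarrow> 'v"
  where "truncated q h = (if h \<in> rel_ball (2 * D) then 0 else q h)"

text \<open>
  The equivariant two-variable form of \<open>q\<close>: pairs of points of \<open>H\<close> that start at \<open>\<one>\<close> get the value of
  the truncated \<open>q\<close>, and pairs in other cosets get the translates of these values.
\<close>

definition coset_term :: "('g \<Rightarrow> 'v) \<Rightarrow> 'g \<Rightarrow> 'g \<Rightarrow> 'v"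
  where "coset_term q u v = act u (truncated q (inv u \<otimes> v))"

definition coset_avg :: "('g \<Rightarrow> 'v) \<Rightarrow> 'g set \<Rightarrow> 'g \<Rightarrow> 'g \<Rightarrow> 'v"
  where "coset_avg q A f g = avg (proj A f) (\<lambda>u. avg (proj A g) (coset_term q u))"

definition coset_sum :: "('g \<Rightarrow> 'v) \<Rightarrow> 'g \<Rightarrow> 'g \<Rightarrow> 'v"
  where "coset_sum q f g = (\<Sum>A \<in> separators f g. coset_avg q A f g)"

lemma coset_term_near: "u \<in> carrier G \<Longrightarrow> inv u \<otimes> v \<in> rel_ball (2 * D) \<Longrightarrow> coset_term q u v = 0"
  by (simp add: coset_term_def truncated_def act_zero)

lemma coset_avg_nonzero:
  assumes A: "A \<in> cosets" and nz: "coset_avg q A f g \<noteq> 0"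
  obtains u v where "u \<in> proj A f" "v \<in> proj A g" "inv u \<otimes> v \<notin> rel_ball (2 * D)"
proof -
  have "\<exists>u \<in> proj A f. \<exists>v \<in> proj A g. coset_term q u v \<noteq> 0"
  proof (rule ccontr)
    assume "\<not> ?thesis"
    then have "coset_avg q A f g = 0" unfolding coset_avg_def by (intro avg_zero) auto
    with nz show False by contradiction
  qed
  then obtain u v where uv: "u \<in> proj A f" "v \<in> proj A g" "coset_term q u v \<noteq> 0" by blast
  then have "inv u \<otimes> v \<notin> rel_ball (2 * D)" using coset_term_near proj_carrier[OF A] by blast
  with that uv show ?thesis by blast
qed

lemma coset_avg_not_separator:
  assumes "A \<in> cosets" "A \<notin> separators f g"
  shows "coset_avg q A f g = 0"
proof (rule ccontr)
  assume "coset_avg q A f g \<noteq> 0"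
  from coset_avg_nonzero[OF assms(1) this] obtain u v
    where "u \<in> proj A f" "v \<in> proj A g" "inv u \<otimes> v \<notin> rel_ball (2 * D)" .
  moreover have "rel_ball D \<subseteq> rel_ball (2 * D)" by (rule rel_ball_mono) simp
  ultimately show False using assms by (auto simp: separators_def)
qed

lemma coset_sum_superset:
  assumes "finite Z" "separators f g \<subseteq> Z" "Z \<subseteq> cosets"
  shows "coset_sum q f g = (\<Sum>A \<in> Z. coset_avg q A f g)"
  unfolding coset_sum_def using assms coset_avg_not_separator by (intro sum.mono_neutral_left) blast+

lemma coset_avg_two_separators:
  assumes A: "A \<in> cosets" and nz: "coset_avg q A f g \<noteq> 0"
  shows "A \<in> separators f h \<or> A \<in> separators h g"
proof -
  from coset_avg_nonzero[OF A nz] obtain u v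
    where uv: "u \<in> proj A f" "v \<in> proj A g" "inv u \<otimes> v \<notin> rel_ball (2 * D)" .
  obtain w where w: "w \<in> proj A h" using proj_nonempty[OF coset_clique[OF A]] by blast
  have "inv u \<otimes> v = (inv u \<otimes> w) \<otimes> (inv w \<otimes> v)"
    using uv w proj_carrier[OF A] inv_mult_chain by simp
  then have "inv u \<otimes> w \<notin> rel_ball D \<or> inv w \<otimes> v \<notin> rel_ball D"
    using uv(3) rel_ball_mult[of "inv u \<otimes> w" D "inv w \<otimes> v" D] by (auto simp: mult_2)
  then show ?thesis using A uv w unfolding separators_def by blast
qed

lemma coset_term_left:
  assumes "k \<in> carrier G" "u \<in> carrier G" "v \<in> carrier G"
  shows "coset_term q (k \<otimes> u) (k \<otimes> v) = act k (coset_term q u v)"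
  using assms by (simp add: coset_term_def inv_mult_left act_mult)

lemma coset_avg_left:
  assumes A: "A \<in> cosets" and c: "k \<in> carrier G" "f \<in> carrier G" "g \<in> carrier G"
  shows "coset_avg q (k <# A) (k \<otimes> f) (k \<otimes> g) = act k (coset_avg q A f g)"
proof -
  have inj: "inj_on ((\<otimes>) k) (proj A x)" for x
    using c(1) proj_carrier[OF A] by (auto intro!: inj_onI)
  show ?thesis
    unfolding coset_avg_def proj_left[OF c(1) coset_carrier[OF A] c(2)]
      proj_left[OF c(1) coset_carrier[OF A] c(3)] avg_reindex[OF inj] act_avg[OF c(1)]
    by (intro avg_cong coset_term_left proj_carrier[OF A] c(1))
qed

lemma coset_sum_left:
  assumes c: "k \<in> carrier G" "f \<in> carrier G" "g \<in> carrier G"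
  shows "coset_sum q (k \<otimes> f) (k \<otimes> g) = act k (coset_sum q f g)"
proof -
  have inj: "inj_on ((<#) k) (separators f g)"
  proof (rule inj_onI)
    fix A B assume AB: "A \<in> separators f g" "B \<in> separators f g" "k <# A = k <# B"
    have "inv k <# (k <# A) = A" if "A \<in> separators f g" for A
      using coset_carrier[OF separators_coset[OF that]] c(1) by (simp add: lcos_m_assoc lcos_mult_one)
    with AB show "A = B" by metis
  qed
  show ?thesis
    unfolding coset_sum_def separators_left[OF c] act_sum[OF c(1)]
    using coset_avg_left[OF separators_coset c] by (simp add: sum.reindex[OF inj])
qed

lemma proj_self:
  assumes "A \<in> cosets" "u \<in> A"
  shows "proj A u = {u}"
proof -
  have "cdst A u = 0" using cdst_le[OF assms(2), of u] by simp
  then show ?thesis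
    using assms coset_carrier[OF assms(1)] hops_eq_0 by (auto simp: proj_def)
qed

text \<open>
  Points of \<open>H\<close> are at distance at most one, so no coset other than \<open>H\<close> itself fits between them.
\<close>

lemma coset_sum_on_H:
  assumes "h \<in> H"
  shows "coset_sum q \<one> h = truncated q h"
proof -
  have one: "\<one> \<in> H" using subgroup.one_closed[OF subgroup_H] .
  have "A = H" if A: "A \<in> separators \<one> h" for A
  proof -
    note cA = separators_coset[OF A]
    have "dst \<one> h = cdst A \<one> + 1 + cdst A h"
      using crosses_hops[OF separators_cross coset_clique[OF cA]] A H_carrier[OF assms] by simp
    then have "cdst A \<one> = 0" using coset_hops[OF H_coset one assms] by simp
    moreover obtain a where "a \<in> proj A \<one>" using proj_nonempty[OF coset_clique[OF cA]] by blast
    ultimately have "\<one> \<in> A"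
      using hops_eq_0[of \<one> a] coset_carrier[OF cA] by (auto simp: proj_def)
    then show ?thesis using coset_disjoint[OF cA H_coset] one by blast
  qed
  then have "coset_sum q \<one> h = (\<Sum>A \<in> {H}. coset_avg q A \<one> h)"
    using H_coset by (intro coset_sum_superset) auto
  also have "\<dots> = coset_term q \<one> h"
    using proj_self[OF H_coset one] proj_self[OF H_coset assms]
    by (simp add: coset_avg_def avg_const[of "{_}"] avg_def scale_one)
  finally show ?thesis using H_carrier[OF assms] by (simp add: coset_term_def act_one)
qed

lemma coset_sum_add:
  assumes "\<And>h. h \<in> H \<Longrightarrow> r h = p h + q h"
  shows "coset_sum r f g = coset_sum p f g + coset_sum q f g"
proof -
  have "coset_term r u v = coset_term p u v + coset_term q u v"
    if "A \<in> cosets" "u \<in> proj A f" "v \<in> proj A g" for A u v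
    using that coset_diff[OF that(1)] assms proj_carrier[OF that(1)] proj_sub
    by (auto simp: coset_term_def truncated_def act_add act_zero subset_iff)
  then have "coset_avg r A f g = coset_avg p A f g + coset_avg q A f g" if "A \<in> cosets" for A
    unfolding coset_avg_def avg_add[symmetric] using that by (intro avg_cong) auto
  then show ?thesis by (simp add: coset_sum_def separators_coset sum.distrib)
qed

lemma coset_sum_scale:
  assumes "a \<in> F" "\<And>h. h \<in> H \<Longrightarrow> r h = scale a (q h)"
  shows "coset_sum r f g = scale a (coset_sum q f g)"
proof -
  have "coset_term r u v = scale a (coset_term q u v)"
    if "A \<in> cosets" "u \<in> proj A f" "v \<in> proj A g" for A u v
    using that coset_diff[OF that(1)] assms proj_carrier[OF that(1)] proj_sub
    by (auto simp: coset_term_def truncated_def act_scale act_zero subset_iff scale_zero_right)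
  then have "coset_avg r A f g = scale a (coset_avg q A f g)" if "A \<in> cosets" for A
    unfolding coset_avg_def avg_scale[OF assms(1), symmetric] using that by (intro avg_cong) auto
  then show ?thesis by (simp add: coset_sum_def separators_coset scale_sum[OF assms(1)])
qed

end

locale antisymmetric_on_H =
  coset_averaging G H X F scale nrm act
  for G :: "('g, 'm) monoid_scheme" (structure) and H X :: "'g set" and F :: "complex set"
    and scale :: "complex \<Rightarrow> 'v::ab_group_add \<Rightarrow> 'v" and nrm :: "'v \<Rightarrow> real"
    and act :: "'g \<Rightarrow> 'v \<Rightarrow> 'v" +
  fixes q :: "'g \<Rightarrow> 'v"
  assumes antisym_on_H: "h \<in> H \<Longrightarrow> q (inv h) = - act (inv h) (q h)"
begin

lemma truncated_antisym:
  assumes "h \<in> H"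
  shows "truncated q (inv h) = - act (inv h) (truncated q h)"
proof -
  have "inv h \<in> rel_ball (2 * D) \<longleftrightarrow> h \<in> rel_ball (2 * D)"
    using rel_ball_inv[of h] rel_ball_inv[of "inv h"] H_carrier[OF assms] by auto
  then show ?thesis using antisym_on_H[OF assms] H_carrier[OF assms] by (simp add: truncated_def act_zero)
qed

lemma coset_term_swap:
  assumes "A \<in> cosets" "u \<in> A" "v \<in> A"
  shows "coset_term q v u = - coset_term q u v"
proof -
  have c: "u \<in> carrier G" "v \<in> carrier G" using assms coset_carrier by auto
  have "truncated q (inv v \<otimes> u) = - act (inv v \<otimes> u) (truncated q (inv u \<otimes> v))"
    using truncated_antisym[OF coset_diff[OF assms]] c by (simp add: inv_inv_mult)
  then show ?thesis
    using c by (simp add: coset_term_def act_minus act_mult[symmetric] m_assoc[symmetric])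
qed

lemma coset_avg_swap:
  assumes "A \<in> cosets"
  shows "coset_avg q A g f = - coset_avg q A f g"
proof -
  have "coset_avg q A g f = avg (proj A f) (\<lambda>u. avg (proj A g) (\<lambda>v. coset_term q v u))"
    unfolding coset_avg_def by (rule avg_swap)
  also have "\<dots> = avg (proj A f) (\<lambda>u. avg (proj A g) (\<lambda>v. - coset_term q u v))"
    by (intro avg_cong coset_term_swap[OF assms]) (use proj_sub in blast)+
  finally show ?thesis by (simp add: coset_avg_def avg_minus)
qed

lemma coset_sum_swap: "coset_sum q g f = - coset_sum q f g"
  unfolding coset_sum_def separators_sym[of g f] sum_negf[symmetric]
  by (intro sum.cong refl coset_avg_swap) (rule separators_coset)

definition defect :: "'g set \<Rightarrow> 'g \<Rightarrow> 'g \<Rightarrow> 'g \<Rightarrow> 'v"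
  where "defect A f g h = coset_avg q A f g + coset_avg q A g h + coset_avg q A h f"

text \<open>
  If \<open>A\<close> projects \<open>g\<close> and \<open>h\<close> to the same set, then it does not separate \<open>g\<close> from \<open>h\<close>, and the averages
  for the other two sides are negatives of each other.
\<close>

lemma defect_branching:
  assumes A: "A \<in> cosets" and c: "f \<in> carrier G" "g \<in> carrier G" "h \<in> carrier G"
    and nz: "defect A f g h \<noteq> 0" and sep: "A \<in> separators f g" "A \<in> separators f h"
  shows "A \<in> branching f g h"
proof -
  have "proj A g \<noteq> proj A h"
  proof
    assume eq: "proj A g = proj A h"
    have "A \<notin> separators g h"
      using proj_diff_rel_ball[OF A c(2)] eq by (auto simp: separators_def)
    then have "coset_avg q A g h = 0" by (rule coset_avg_not_separator[OF A])
    moreover have "coset_avg q A h f = - coset_avg q A f g"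
      using coset_avg_swap[OF A, of g f] eq by (simp add: coset_avg_def)
    ultimately show False using nz by (simp add: defect_def)
  qed
  then show ?thesis using sep by (simp add: branching_def)
qed

lemma defect_support:
  assumes A: "A \<in> cosets" and c: "f \<in> carrier G" "g \<in> carrier G" "h \<in> carrier G"
    and nz: "defect A f g h \<noteq> 0"
  shows "A \<in> branching f g h \<union> branching g h f \<union> branching h f g"
proof -
  have rot: "defect A g h f = defect A f g h" "defect A h f g = defect A f g h"
    by (simp_all add: defect_def algebra_simps)
  have "coset_avg q A f g \<noteq> 0 \<or> coset_avg q A g h \<noteq> 0 \<or> coset_avg q A h f \<noteq> 0"
    using nz by (auto simp: defect_def)
  then have "(A \<in> separators f g \<and> A \<in> separators f h) \<or>
      (A \<in> separators g h \<and> A \<in> separators g f) \<or> (A \<in> separators h f \<and> A \<in> separators h g)"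
    using coset_avg_two_separators[OF A] coset_avg_not_separator[OF A] separators_sym by metis
  then show ?thesis
    using defect_branching[OF A c nz] defect_branching[OF A c(2,3,1)] defect_branching[OF A c(3,1,2)] nz rot
    by auto
qed

end

locale quasi_cocycle_on_H =
  antisymmetric_on_H G H X F scale nrm act q
  for G :: "('g, 'm) monoid_scheme" (structure) and H X :: "'g set" and F :: "complex set"
    and scale :: "complex \<Rightarrow> 'v::ab_group_add \<Rightarrow> 'v" and nrm :: "'v \<Rightarrow> real"
    and act :: "'g \<Rightarrow> 'v \<Rightarrow> 'v"
    and q :: "'g \<Rightarrow> 'v" +
  fixes \<epsilon> M :: real
  assumes quasi: "h \<in> H \<Longrightarrow> k \<in> H \<Longrightarrow> nrm (q (h \<otimes> k) - q h - act h (q k)) \<le> \<epsilon>"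
    and bounded_ball: "h \<in> rel_ball (2 * D) \<Longrightarrow> nrm (q h) \<le> M"
begin

lemma M_nonneg: "0 \<le> M"
  using bounded_ball[OF one_rel_ball] nrm_nonneg order_trans by blast

lemma \<epsilon>_nonneg: "0 \<le> \<epsilon>"
  using quasi[of \<one> \<one>] subgroup.one_closed[OF subgroup_H] nrm_nonneg order_trans by blast

lemma truncated_close: "nrm (q h - truncated q h) \<le> M"
  using bounded_ball M_nonneg by (simp add: truncated_def nrm_zero)

text \<open>
  Without truncation the sum over a triangle is, up to sign, a translate of the defect of \<open>q\<close>;
  truncation changes each of its three terms by at most \<open>M\<close>.
\<close>

lemma coset_term_triangle:
  assumes A: "A \<in> cosets" and uvw: "u \<in> A" "v \<in> A" "w \<in> A"
  shows "nrm (coset_term q u v + coset_term q v w + coset_term q w u) \<le> \<epsilon> + 3 * M"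
proof -
  have c: "u \<in> carrier G" "v \<in> carrier G" "w \<in> carrier G" using uvw coset_carrier[OF A] by auto
  define full where "full x y = act x (q (inv x \<otimes> y))" for x y
  have close: "nrm (full x y - coset_term q x y) \<le> M" if "x \<in> carrier G" for x y
    unfolding full_def coset_term_def act_diff[OF that, symmetric] act_isometry[OF that] by (rule truncated_close)
  have swap: "full w u = - full u w"
    using antisym_on_H[OF coset_diff[OF A uvw(1,3)]] c
    by (simp add: full_def inv_inv_mult act_minus act_mult[symmetric] m_assoc[symmetric])
  have "full v w = act u (act (inv u \<otimes> v) (q (inv v \<otimes> w)))"
    using c by (simp add: full_def act_mult[symmetric] m_assoc[symmetric])
  then have "full u w - full u v - full v w =
      act u (q ((inv u \<otimes> v) \<otimes> (inv v \<otimes> w)) - q (inv u \<otimes> v) - act (inv u \<otimes> v) (q (inv v \<otimes> w)))"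
    using c by (simp add: full_def act_diff inv_mult_chain)
  then have "nrm (full u w - full u v - full v w) \<le> \<epsilon>"
    using quasi[OF coset_diff[OF A uvw(1,2)] coset_diff[OF A uvw(2,3)]] act_isometry[OF c(1)] by simp
  moreover have eq: "coset_term q u v + coset_term q v w + coset_term q w u = - (full u w - full u v - full v w)
      - (full u v - coset_term q u v) - (full v w - coset_term q v w) - (full w u - coset_term q w u)"
    unfolding swap by simp
  have "nrm (coset_term q u v + coset_term q v w + coset_term q w u) \<le> nrm (full u w - full u v - full v w)
      + nrm (full u v - coset_term q u v) + nrm (full v w - coset_term q v w) + nrm (full w u - coset_term q w u)"
    unfolding eq by (rule order_trans[OF nrm_diff4]) (simp only: nrm_minus order.refl)
  ultimately show ?thesis using close[OF c(1), of v] close[OF c(2), of w] close[OF c(3), of u] by linarith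
qed

text \<open>
  The three averages become one average over triples of projection points, after inserting averages
  of constants.
\<close>

lemma defect_bound:
  assumes A: "A \<in> cosets" and c: "f \<in> carrier G" "g \<in> carrier G" "h \<in> carrier G"
  shows "nrm (defect A f g h) \<le> \<epsilon> + 3 * M"
proof -
  have ne: "proj A x \<noteq> {}" for x using proj_nonempty[OF coset_clique[OF A]] .
  note const = avg_const[OF finite_proj[OF A] ne]
  have "coset_avg q A h f = avg (proj A f) (\<lambda>u. avg (proj A h) (\<lambda>w. coset_term q w u))"
    unfolding coset_avg_def by (rule avg_swap)
  then have "defect A f g h = avg (proj A f) (\<lambda>u. avg (proj A g) (\<lambda>v. avg (proj A h) (\<lambda>w.
      coset_term q u v + coset_term q v w + coset_term q w u)))"
    unfolding defect_def avg_add const[OF c(1)] const[OF c(2)] const[OF c(3)]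
    by (simp add: coset_avg_def)
  moreover have "nrm \<dots> \<le> \<epsilon> + 3 * M"
    using proj_sub coset_term_triangle[OF A]
    by (intro avg_norm_le finite_proj[OF A] ne c) blast
  ultimately show ?thesis by simp
qed

text \<open>
  Only the branching cosets of the three corners contribute, and each corner has at most one.
\<close>

lemma coset_sum_triangle:
  assumes c: "f \<in> carrier G" "g \<in> carrier G" "h \<in> carrier G"
  shows "nrm (coset_sum q f g + coset_sum q g h + coset_sum q h f) \<le> 3 * (\<epsilon> + 3 * M)"
proof -
  define Z where "Z = separators f g \<union> separators g h \<union> separators h f"
  define B where "B = branching f g h \<union> branching g h f \<union> branching h f g"
  have Z: "finite Z" "Z \<subseteq> cosets" using finite_separators c separators_coset by (auto simp: Z_def)
  have B: "finite B" "card B \<le> 3"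
  proof -
    show "finite B" using branching_at_most_one c by (simp add: B_def)
    have "card B \<le> card (branching f g h) + card (branching g h f) + card (branching h f g)"
      unfolding B_def by (meson card_Un_le add_le_mono1 order_trans)
    then show "card B \<le> 3"
      using branching_at_most_one(2)[OF c] branching_at_most_one(2)[OF c(2,3,1)]
        branching_at_most_one(2)[OF c(3,1,2)] by linarith
  qed
  have sub: "separators f g \<subseteq> Z" "separators g h \<subseteq> Z" "separators h f \<subseteq> Z" by (auto simp: Z_def)
  have "coset_sum q f g = (\<Sum>A \<in> Z. coset_avg q A f g)" "coset_sum q g h = (\<Sum>A \<in> Z. coset_avg q A g h)"
      "coset_sum q h f = (\<Sum>A \<in> Z. coset_avg q A h f)"
    using sub[THEN coset_sum_superset[OF Z(1) _ Z(2)]] by simp_all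
  then have "coset_sum q f g + coset_sum q g h + coset_sum q h f = (\<Sum>A \<in> Z. defect A f g h)"
    by (simp only: defect_def sum.distrib)
  also have "\<dots> = (\<Sum>A \<in> Z \<inter> B. defect A f g h)"
    using defect_support[OF _ c] Z by (intro sum.mono_neutral_right) (auto simp: B_def)
  finally have "nrm (coset_sum q f g + coset_sum q g h + coset_sum q h f) \<le> real (card (Z \<inter> B)) * (\<epsilon> + 3 * M)"
    using nrm_sum[of "Z \<inter> B" "\<lambda>A. defect A f g h"] defect_bound[OF _ c] Z by auto
  also have "real (card (Z \<inter> B)) \<le> 3"
    using card_mono[OF B(1), of "Z \<inter> B"] B(2) by simp
  then have "real (card (Z \<inter> B)) * (\<epsilon> + 3 * M) \<le> 3 * (\<epsilon> + 3 * M)"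
    using M_nonneg \<epsilon>_nonneg by (intro mult_right_mono) auto
  finally show ?thesis .
qed

lemma coset_sum_quasi_cocycle:
  assumes c: "f \<in> carrier G" "g \<in> carrier G"
  shows "nrm (coset_sum q \<one> (f \<otimes> g) - coset_sum q \<one> f - act f (coset_sum q \<one> g)) \<le> 3 * (\<epsilon> + 3 * M)"
proof -
  have "act f (coset_sum q \<one> g) = coset_sum q f (f \<otimes> g)" using coset_sum_left[of f \<one> g q] c by simp
  then have eq: "coset_sum q \<one> (f \<otimes> g) - coset_sum q \<one> f - act f (coset_sum q \<one> g) =
      - (coset_sum q \<one> f + coset_sum q f (f \<otimes> g) + coset_sum q (f \<otimes> g) \<one>)"
    using coset_sum_swap[of "f \<otimes> g" \<one>] by simp
  show ?thesis unfolding eq nrm_minus using coset_sum_triangle[of \<one> f "f \<otimes> g"] c by simp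
qed

end

context coset_averaging
begin

text \<open>
  The sum over cosets agrees with \<open>q\<close> on \<open>H\<close> only outside the finite ball on which \<open>q\<close> was truncated, so
  its values on \<open>H\<close> are replaced.
\<close>

definition extension :: "('g \<Rightarrow> 'v) \<Rightarrow> 'g \<Rightarrow> 'v"
  where "extension q = (\<lambda>g \<in> carrier G. if g \<in> H then q g else coset_sum q \<one> g)"

lemma extension_QZ1:
  assumes q: "q \<in> QZ1_as (G\<lparr>carrier := H\<rparr>) act nrm U"
  shows "extension q \<in> QZ1_as G act nrm UNIV"
proof -
  have antisym_on_H: "q (inv h) = - act (inv h) (q h)" if "h \<in> H" for h
    using q that m_inv_consistent[OF subgroup_H that] by (auto simp: QZ1_as_def antisymmetric_def)
  obtain \<epsilon> where \<epsilon>: "\<And>h k. h \<in> H \<Longrightarrow> k \<in> H \<Longrightarrow> nrm (q (h \<otimes> k) - q h - act h (q k)) \<le> \<epsilon>"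
    using q by (auto simp: QZ1_as_def quasi_cocycle_def)
  define M where "M = Max ((\<lambda>h. nrm (q h)) ` rel_ball (2 * D))"
  have M: "nrm (q h) \<le> M" if "h \<in> rel_ball (2 * D)" for h
    unfolding M_def using finite_rel_ball that by (intro Max_ge) auto
  interpret quasi_cocycle_on_H G H X F scale nrm act q \<epsilon> M
    by unfold_locales (use antisym_on_H \<epsilon> M in auto)
  have close: "nrm (extension q g - coset_sum q \<one> g) \<le> M" if "g \<in> carrier G" for g
    using that truncated_close coset_sum_on_H M_nonneg by (simp add: extension_def nrm_zero)
  have "nrm (extension q (f \<otimes> g) - extension q f - act f (extension q g)) \<le> 3 * (\<epsilon> + 3 * M) + 3 * M"
    if c: "f \<in> carrier G" "g \<in> carrier G" for f g
  proof -
    \<comment> \<open>The correction \<open>e\<close> is bounded by \<open>M\<close>, and the defect involves it three times.\<close>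
    define e where "e x = extension q x - coset_sum q \<one> x" for x
    have "act f (extension q g) = act f (coset_sum q \<one> g) + act f (e g)"
      by (simp add: e_def flip: act_add[OF c(1)])
    then have "extension q (f \<otimes> g) - extension q f - act f (extension q g) =
        (coset_sum q \<one> (f \<otimes> g) - coset_sum q \<one> f - act f (coset_sum q \<one> g)) - (- e (f \<otimes> g)) - e f - act f (e g)"
      by (simp add: e_def)
    then have "nrm (extension q (f \<otimes> g) - extension q f - act f (extension q g)) \<le>
        nrm (coset_sum q \<one> (f \<otimes> g) - coset_sum q \<one> f - act f (coset_sum q \<one> g))
        + nrm (e (f \<otimes> g)) + nrm (e f) + nrm (act f (e g))"
      using nrm_diff4[of _ "- e (f \<otimes> g)" "e f" "act f (e g)"] by (simp add: nrm_minus)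
    then show ?thesis
      using coset_sum_quasi_cocycle[OF c] close[of "f \<otimes> g"] close[OF c(1)] close[OF c(2)] c
        act_isometry[OF c(1), of "e g"] by (simp add: e_def)
  qed
  then have "quasi_cocycle G act nrm (extension q)"
    unfolding quasi_cocycle_def using M_nonneg \<epsilon>_nonneg
    by (intro exI[of _ "3 * (\<epsilon> + 3 * M) + 3 * M + 1"]) (auto intro: order_trans[of _ "3 * (\<epsilon> + 3 * M) + 3 * M"])
  moreover have "extension q (inv g) = - act (inv g) (extension q g)" if g: "g \<in> carrier G" for g
  proof (cases "g \<in> H")
    case True
    then show ?thesis
      using antisym_on_H[OF True] subgroup.m_inv_closed[OF subgroup_H True] g by (simp add: extension_def)
  next
    case False
    then have "inv g \<notin> H" using subgroup.m_inv_closed[OF subgroup_H, of "inv g"] g by auto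
    moreover have "coset_sum q \<one> (inv g) = act (inv g) (coset_sum q g \<one>)"
      using coset_sum_left[of "inv g" g \<one> q] g by simp
    ultimately show ?thesis
      using False g coset_sum_swap[of g \<one>] by (simp add: extension_def act_minus)
  qed
  ultimately show ?thesis
    by (auto simp: QZ1_as_def antisymmetric_def extension_def)
qed

lemma extension_linear:
  "linear_map_between F scale H (carrier G)
     (QZ1_as (G\<lparr>carrier := H\<rparr>) act nrm U) (QZ1_as G act nrm UNIV) extension"
proof -
  have "extension (\<lambda>x\<in>H. p x + q x) = (\<lambda>x\<in>carrier G. extension p x + extension q x)" for p q
    using coset_sum_add[of "\<lambda>x\<in>H. p x + q x" p q] by (auto simp: extension_def fun_eq_iff)
  moreover have "extension (\<lambda>x\<in>H. scale a (p x)) = (\<lambda>x\<in>carrier G. scale a (extension p x))"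
    if "a \<in> F" for a p
    using coset_sum_scale[OF that, of "\<lambda>x\<in>H. scale a (p x)" p] by (auto simp: extension_def fun_eq_iff)
  ultimately show ?thesis
    unfolding linear_map_between_def using extension_QZ1 by blast
qed

end

theorem theorem1p4:
  fixes G :: "('g, 'm) monoid_scheme"
    and H :: "'g set"
    and F :: "complex set"
    and scale :: "complex \<Rightarrow> 'v::ab_group_add \<Rightarrow> 'v"
    and nrm :: "'v \<Rightarrow> real"
    and act :: "'g \<Rightarrow> 'v \<Rightarrow> 'v"
    and U :: "'v set"
  assumes "group G"
    and "hyperbolically_embedded G H"
    and "normed_module F scale nrm G act"
    and "invariant_subspace F scale act H U"
  shows "\<exists>\<iota>. linear_map_between F scale H (carrier G)
               (QZ1_as (G\<lparr>carrier := H\<rparr>) act nrm U) (QZ1_as G act nrm UNIV) \<iota> \<and>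
             (\<forall>q \<in> QZ1_as (G\<lparr>carrier := H\<rparr>) act nrm U. \<forall>h \<in> H. \<iota> q h = q h)"
proof -
  obtain X where X: "hyperbolically_embedded_wrt G H X"
    using assms(2) unfolding hyperbolically_embedded_def by blast
  interpret group G by fact
  interpret normed_module F scale nrm G act by fact
  interpret relative_cayley G H X
    by (rule relative_cayley.intro[OF assms(1)], rule relative_cayley_axioms.intro)
      (use X in \<open>auto simp: hyperbolically_embedded_wrt_def\<close>)
  interpret coset_averaging G H X F scale nrm act
    by unfold_locales (use X in \<open>auto simp: hyperbolically_embedded_wrt_def\<close>)
  have "\<forall>h \<in> H. extension q h = q h" for q
    using H_carrier by (simp add: extension_def)
  with extension_linear show ?thesis by blast
qed

end
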